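(* Let $K\subset \mathbb{R}^n$ be a compact set of positive Lebesgue measure and let $1\leq p<\infty$. Then $K$ is non-removable for $W^{1,p}$; that is, there exists a continuous function $f\colon \mathbb{R}^n\to\mathbb{R}$ such that $f\in W^{1,p}(\mathbb{R}^n\setminus K)$ but $f\notin W^{1,p}(\mathbb{R}^n)$.
   Context: For an open set $U\subset\mathbb{R}^n$ and $p\in[1,\infty]$, $f\in W^{1,p}(U)$ means that $f\in L^p(U)$ and $f$ has weak first partial derivatives in $U$ that lie in $L^p(U)$. A compact set $K\subset\mathbb{R}^n$ is $W^{1,p}$-removable if every real-valued function that is continuous in $\mathbb{R}^n$ and lies in $W^{1,p}(\mathbb{R}^n\setminus K)$ also lies in $W^{1,p}(\mathbb{R}^n)$; otherwise $K$ is non-removable for $W^{1,p}$. *)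

theory Defs
  imports "HOL-Analysis.Analysis"
begin

fun Ck :: "nat \<Rightarrow> ('a::euclidean_space \<Rightarrow> real) \<Rightarrow> bool" where
  "Ck 0 f \<longleftrightarrow> continuous_on UNIV f"
| "Ck (Suc k) f \<longleftrightarrow> f differentiable_on UNIV \<and>
     (\<forall>b\<in>Basis. Ck k (\<lambda>x. frechet_derivative f (at x) b))"

definition smooth :: "('a::euclidean_space \<Rightarrow> real) \<Rightarrow> bool" where
  "smooth f \<longleftrightarrow> (\<forall>k. Ck k f)"

text \<open>A test function in \<open>C\<^sub>c\<^sup>\<infinity>(U)\<close>, for open \<open>U\<close>, is identified with its extension by zero
  to the whole space.\<close>

definition test_function :: "'a::euclidean_space set \<Rightarrow> ('a \<Rightarrow> real) \<Rightarrow> bool" where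
  "test_function U \<phi> \<longleftrightarrow>
     smooth \<phi> \<and> compact (closure {x. \<phi> x \<noteq> 0}) \<and> closure {x. \<phi> x \<noteq> 0} \<subseteq> U"

text \<open>Elements of the function spaces below are functions rather than almost-everywhere classes,
  and they are total: their values outside \<open>U\<close> are irrelevant.\<close>

definition Lp :: "ereal \<Rightarrow> 'a::euclidean_space set \<Rightarrow> ('a \<Rightarrow> real) set" where
  "Lp p U = {f \<in> borel_measurable (lebesgue_on U).
     if p = \<infinity> then \<exists>C. AE x in lebesgue_on U. \<bar>f x\<bar> \<le> C
     else integrable (lebesgue_on U) (\<lambda>x. \<bar>f x\<bar> powr real_of_ereal p)}"

definition locally_integrable :: "'a::euclidean_space set \<Rightarrow> ('a \<Rightarrow> real) \<Rightarrow> bool" where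
  "locally_integrable U f \<longleftrightarrow> (\<forall>C. compact C \<and> C \<subseteq> U \<longrightarrow> integrable (lebesgue_on C) f)"

definition weak_partial_derivative ::
    "'a::euclidean_space set \<Rightarrow> 'a \<Rightarrow> ('a \<Rightarrow> real) \<Rightarrow> ('a \<Rightarrow> real) \<Rightarrow> bool" where
  "weak_partial_derivative U b f g \<longleftrightarrow>
     locally_integrable U f \<and> locally_integrable U g \<and>
     (\<forall>\<phi>. test_function U \<phi> \<longrightarrow>
        (LINT x|lebesgue_on U. f x * frechet_derivative \<phi> (at x) b) =
        - (LINT x|lebesgue_on U. g x * \<phi> x))"

text \<open>The Sobolev space \<open>W\<^sup>1\<^sup>,\<^sup>p(U)\<close>; meaningful for open \<open>U\<close> and \<open>1 \<le> p \<le> \<infinity>\<close>.\<close>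

definition W1p :: "ereal \<Rightarrow> 'a::euclidean_space set \<Rightarrow> ('a \<Rightarrow> real) set" where
  "W1p p U = {f \<in> Lp p U. \<forall>b\<in>Basis. \<exists>g\<in>Lp p U. weak_partial_derivative U b f g}"

text \<open>Meaningful for compact \<open>K\<close>.\<close>

definition W1p_removable :: "ereal \<Rightarrow> 'a::euclidean_space set \<Rightarrow> bool" where
  "W1p_removable p K \<longleftrightarrow>
     (\<forall>f. continuous_on UNIV f \<and> f \<in> W1p p (- K) \<longrightarrow> f \<in> W1p p UNIV)"

end

theory Submission
  imports Defs
begin

text \<open>Take \<open>f = (\<Sum>k. f\<^sub>k)\<close> with \<open>f\<^sub>k x = a\<^sub>k \<psi>\<^sub>k(x) sin (\<theta>\<^sub>k + M\<^sub>k (x \<bullet> b))\<close>, where \<open>\<psi>\<^sub>k\<close> is a smooth cutoff,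
  at least \<open>1/2\<close> on \<open>K\<close> and supported in a neighbourhood \<open>U\<^sub>k\<close> of \<open>K\<close>. The gradient of \<open>f\<^sub>k\<close> is of
  size \<open>G\<^sub>k = a\<^sub>k M\<^sub>k\<close>, with \<open>G\<^sub>k \<rightarrow> \<infinity>\<close> fixed in advance. As the \<open>U\<^sub>k\<close> shrink to \<open>K\<close>, the series is
  locally finite off \<open>K\<close>, and as the measure of \<open>U\<^sub>k - K\<close> is as small as we please in terms of
  \<open>G\<^sub>0, \<dots>, G\<^sub>k\<close>, its gradient off \<open>K\<close> is in \<open>L\<^sup>p\<close>. Testing a weak derivative \<open>g\<close> of \<open>f\<close> on the whole
  space against \<open>\<psi>\<^sub>k(x) cos (\<theta>\<^sub>k + M\<^sub>k (x \<bullet> b))\<close> gives at least a constant times \<open>G\<^sub>k |K|\<close> minus the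
  contributions of the earlier terms, which exceeds the integral of \<open>|g|\<close> over a fixed compact set
  once \<open>k\<close> is large; the later terms are harmless because their amplitudes are tiny compared
  with \<open>1/M\<^sub>k\<close>.\<close>

section \<open>Smooth functions and cutoffs\<close>

text \<open>Derivatives are unique, so the recursion of \<open>Ck\<close> can be run on any explicit
  derivative formula instead of on \<open>frechet_derivative\<close>.\<close>

lemma Ck_SucI:
  assumes "\<And>x. (f has_derivative f' x) (at x)" and "\<And>b. b \<in> Basis \<Longrightarrow> Ck k (\<lambda>x. f' x b)"
  shows "Ck (Suc k) f"
proof -
  have "frechet_derivative f (at x) = f' x" for x
    using assms(1) by (metis frechet_derivative_at)
  with assms show ?thesis
    by (auto simp: differentiable_on_def differentiable_def intro: has_derivative_at_withinI)
qed

lemma Ck_has_derivative: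
  "Ck (Suc k) f \<Longrightarrow> (f has_derivative frechet_derivative f (at x)) (at x)"
  by (auto simp: differentiable_on_def frechet_derivative_works)

lemma Ck_SucD: "Ck (Suc k) f \<Longrightarrow> Ck k f"
  by (induction k arbitrary: f) (auto simp: differentiable_imp_continuous_on)

lemma Ck_const: "Ck k (\<lambda>x. c)"
  by (induction k arbitrary: c) (auto simp del: Ck.simps(2) intro!: Ck_SucI[where f' = "\<lambda>x h. 0"])

lemma Ck_add: "Ck k f \<Longrightarrow> Ck k g \<Longrightarrow> Ck k (\<lambda>x. f x + g x)"
proof (induction k arbitrary: f g)
  case (Suc k)
  show ?case
  proof (rule Ck_SucI)
    show "((\<lambda>x. f x + g x) has_derivative
      (\<lambda>h. frechet_derivative f (at x) h + frechet_derivative g (at x) h)) (at x)" for x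
      using Suc.prems by (intro has_derivative_add Ck_has_derivative)
  qed (use Suc in auto)
qed (auto intro: continuous_intros)

lemma Ck_mult: "Ck k f \<Longrightarrow> Ck k g \<Longrightarrow> Ck k (\<lambda>x. f x * g x)"
proof (induction k arbitrary: f g)
  case (Suc k)
  show ?case
  proof (rule Ck_SucI)
    show "((\<lambda>x. f x * g x) has_derivative
      (\<lambda>h. f x * frechet_derivative g (at x) h + frechet_derivative f (at x) h * g x)) (at x)" for x
      using Suc.prems by (intro has_derivative_mult Ck_has_derivative)
    \<comment> \<open>The product rule keeps one factor undifferentiated; it is given at order
      \<open>Suc k\<close> and lowered to order \<open>k\<close> by \<open>Ck_SucD\<close> before
      the induction hypothesis applies.\<close>
    show "Ck k (\<lambda>x. f x * frechet_derivative g (at x) b + frechet_derivative f (at x) b * g x)"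
      if "b \<in> Basis" for b
      using Suc that Ck_SucD[OF Suc.prems(1)] Ck_SucD[OF Suc.prems(2)]
      by (intro Ck_add Suc.IH) auto
  qed
qed (auto intro: continuous_intros)

text \<open>\<open>F\<close> lists the successive derivatives of one function of a real variable.
  Differentiating the ridge function moves \<open>F i\<close> to \<open>F (Suc i)\<close> and adds a
  constant factor, so the induction must run over all \<open>i\<close> at once.\<close>

lemma Ck_ridge:
  assumes "\<And>i t. (F i has_field_derivative F (Suc i) t) (at t)"
  shows "Ck k (\<lambda>x. F i (a + x \<bullet> v))"
proof (induction k arbitrary: i)
  case 0
  have "continuous_on UNIV (F i)"
    using assms by (meson DERIV_isCont continuous_at_imp_continuous_on)
  then show ?case
    by (auto intro!: continuous_intros continuous_on_compose2[of UNIV "F i"])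
next
  case (Suc k)
  show ?case
  proof (rule Ck_SucI)
    have "((\<lambda>x. a + x \<bullet> v) has_derivative (\<lambda>h. h \<bullet> v)) (at x)" for x
      by (auto intro!: derivative_eq_intros)
    from has_derivative_compose[OF this, of "F i" "(*) (F (Suc i) (a + x \<bullet> v))" for x] assms
    show "((\<lambda>x. F i (a + x \<bullet> v)) has_derivative (\<lambda>h. F (Suc i) (a + x \<bullet> v) * (h \<bullet> v))) (at x)" for x
      by (auto simp: has_field_derivative_def)
    show "Ck k (\<lambda>x. F (Suc i) (a + x \<bullet> v) * (b \<bullet> v))" if "b \<in> Basis" for b
      by (intro Ck_mult Suc.IH Ck_const)
  qed
qed

lemma smooth_const: "smooth (\<lambda>x. c)"
  and smooth_add: "smooth f \<Longrightarrow> smooth g \<Longrightarrow> smooth (\<lambda>x. f x + g x)"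
  and smooth_mult: "smooth f \<Longrightarrow> smooth g \<Longrightarrow> smooth (\<lambda>x. f x * g x)"
  by (auto simp: smooth_def Ck_const Ck_add Ck_mult)

lemma smooth_diff: "smooth f \<Longrightarrow> smooth g \<Longrightarrow> smooth (\<lambda>x. f x - g x)"
  using smooth_add[OF _ smooth_mult[OF smooth_const], of f g "-1"] by simp

lemma smooth_prod: "(\<And>i. i \<in> I \<Longrightarrow> smooth (f i)) \<Longrightarrow> smooth (\<lambda>x. \<Prod>i\<in>I. f i x)"
  by (induction I rule: infinite_finite_induct) (auto intro: smooth_const smooth_mult)

lemma smooth_sum: "(\<And>i. i \<in> I \<Longrightarrow> smooth (f i)) \<Longrightarrow> smooth (\<lambda>x. \<Sum>i\<in>I. f i x)"
  by (induction I rule: infinite_finite_induct) (auto intro: smooth_const smooth_add)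

lemma smooth_power: "smooth f \<Longrightarrow> smooth (\<lambda>x. f x ^ n)"
  by (induction n) (auto intro: smooth_const smooth_mult)

lemma smooth_has_derivative:
  "smooth f \<Longrightarrow> (f has_derivative frechet_derivative f (at x)) (at x)"
  using Ck_has_derivative[of 0] unfolding smooth_def by blast

lemma smooth_continuous_on: "smooth f \<Longrightarrow> continuous_on UNIV f"
  unfolding smooth_def by (metis Ck.simps(1))

lemma smooth_partial: "smooth f \<Longrightarrow> b \<in> Basis \<Longrightarrow> smooth (\<lambda>x. frechet_derivative f (at x) b)"
  unfolding smooth_def by (metis Ck.simps(2))

lemma smooth_ridge:
  assumes "\<And>i t. (F i has_field_derivative F (Suc i) t) (at t)"
  shows "smooth (\<lambda>x. F i (a + x \<bullet> v))"
  unfolding smooth_def by (intro allI Ck_ridge[where F = F] assms)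

lemma smooth_sin: "smooth (\<lambda>x. sin (a + x \<bullet> v))"
proof -
  \<comment> \<open>Each derivative of the sine advances its phase by a quarter period, which gives
    all derivatives in closed form.\<close>
  define F where "F i t = sin (t + real i * (pi/2))" for i t
  have half: "sin (u + pi/2) = cos u" for u by (simp add: sin_add)
  have "F (Suc i) t = cos (t + real i * (pi/2))" for i t
    unfolding F_def half[symmetric] by (simp add: algebra_simps add_divide_distrib)
  then have "(F i has_field_derivative F (Suc i) t) (at t)" for i t
    unfolding F_def by (auto intro!: derivative_eq_intros)
  then have "smooth (\<lambda>x. F 0 (a + x \<bullet> v))" by (rule smooth_ridge)
  then show ?thesis by (simp add: F_def)
qed

lemma smooth_cos: "smooth (\<lambda>x. cos (a + x \<bullet> v))"
  using smooth_sin[of "a + pi/2" v] by (simp add: sin_add cos_add add.commute add.left_commute)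

text \<open>The functions \<open>t \<mapsto> P (1/t) exp (-1/t)\<close>, cut off at \<open>0\<close>, are closed under differentiation.\<close>

definition flat :: "real poly \<Rightarrow> real \<Rightarrow> real" where
  "flat P t = (if t > 0 then poly P (1 / t) * exp (- (1 / t)) else 0)"

text \<open>Each monomial loses against the exponential. With \<open>s = 1/h\<close> this makes the
  difference quotients of \<open>flat P\<close> at 0 vanish.\<close>

lemma tendsto_poly_exp_neg:
  fixes P :: "real poly"
  shows "((\<lambda>s. poly P s * exp (- s)) \<longlongrightarrow> 0) at_top"
proof -
  have "((\<lambda>s. \<Sum>i\<le>degree P. coeff P i * (s ^ i / exp s)) \<longlongrightarrow> (\<Sum>i\<le>degree P. coeff P i * 0)) at_top"
    by (intro tendsto_intros tendsto_power_div_exp_0)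
  then show ?thesis
    by (simp add: poly_altdef sum_distrib_right sum_divide_distrib exp_minus field_simps)
qed

text \<open>For t > 0 the chain rule turns P(1/t) exp(-1/t) into (1/t)^2 (P - P')(1/t) exp(-1/t),
  and \<open>[:0, 0, 1:]\<close> encodes the factor (1/t)^2. At 0 the two one-sided difference
  quotients are treated separately.\<close>

lemma flat_deriv:
  "(flat P has_field_derivative flat ([:0, 0, 1:] * (P - pderiv P)) t) (at t)"
proof (cases t "0::real" rule: linorder_cases)
  case less
  have "((\<lambda>t. 0) has_field_derivative 0) (at t)" by simp
  then have "(flat P has_field_derivative 0) (at t)"
    by (rule has_field_derivative_transform_within_open[of _ _ _ "{..<0}"])
       (use less in \<open>auto simp: flat_def\<close>)
  with less show ?thesis by (simp add: flat_def)
next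
  case greater
  have inv: "((\<lambda>t. 1 / t) has_field_derivative - ((1 / t) * (1 / t))) (at t)"
    using greater by (auto intro!: derivative_eq_intros)
  have "((\<lambda>t. poly P (1 / t)) has_field_derivative poly (pderiv P) (1 / t) * - ((1 / t) * (1 / t))) (at t)"
    by (rule DERIV_chain2[OF poly_DERIV inv])
  moreover have "((\<lambda>t. exp (- (1 / t))) has_field_derivative exp (- (1 / t)) * ((1 / t) * (1 / t))) (at t)"
    using DERIV_chain2[OF DERIV_exp DERIV_minus[OF inv]] by simp
  ultimately have "((\<lambda>t. poly P (1 / t) * exp (- (1 / t))) has_field_derivative
    flat ([:0, 0, 1:] * (P - pderiv P)) t) (at t)"
    using greater
    by (auto intro!: DERIV_cong[OF DERIV_mult] simp: flat_def algebra_simps)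
  then show ?thesis
    by (rule has_field_derivative_transform_within_open[of _ _ _ "{0<..}"])
       (use greater in \<open>auto simp: flat_def\<close>)
next
  case equal
  have "((\<lambda>h. flat P h / h) \<longlongrightarrow> 0) (at_right 0)"
  proof -
    \<comment> \<open>Dividing by h multiplies the polynomial in 1/h by its variable, hence the
      factor \<open>[:0, 1:]\<close>.\<close>
    have "((\<lambda>h. poly ([:0, 1:] * P) (inverse h) * exp (- inverse h)) \<longlongrightarrow> 0) (at_right 0)"
      by (rule filterlim_compose[OF tendsto_poly_exp_neg filterlim_inverse_at_top_right])
    then show ?thesis
    proof (rule Lim_transform_eventually)
      show "\<forall>\<^sub>F h in at_right 0. poly ([:0, 1:] * P) (inverse h) * exp (- inverse h) = flat P h / h"
        using eventually_at_right_less[of "0::real"]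
        by eventually_elim (simp add: flat_def inverse_eq_divide)
    qed
  qed
  moreover have "((\<lambda>h. flat P h / h) \<longlongrightarrow> 0) (at_left 0)"
  proof (rule Lim_transform_eventually[OF tendsto_const])
    show "\<forall>\<^sub>F h in at_left 0. 0 = flat P h / h"
      by (auto simp: eventually_at_filter flat_def)
  qed
  ultimately have "((\<lambda>h. flat P h / h) \<longlongrightarrow> 0) (at 0)"
    by (simp add: filterlim_at_split)
  with equal show ?thesis by (simp add: DERIV_def flat_def)
qed

lemma smooth_flat: "smooth (\<lambda>x. flat P (a + x \<bullet> v))"
proof -
  define Q where "Q i = ((\<lambda>P. [:0, 0, 1:] * (P - pderiv P)) ^^ i) P" for i
  have "(flat (Q i) has_field_derivative flat (Q (Suc i)) t) (at t)" for i t
    using flat_deriv[of "Q i" t] by (simp add: Q_def)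
  then have "smooth (\<lambda>x. flat (Q 0) (a + x \<bullet> v))" by (rule smooth_ridge)
  then show ?thesis by (simp add: Q_def)
qed

section \<open>Test functions with prescribed support: bumps and cutoffs\<close>

lemma test_functionI:
  assumes "smooth \<phi>" "compact C" "C \<subseteq> U" "\<And>x. x \<notin> C \<Longrightarrow> \<phi> x = 0"
  shows "test_function U \<phi>"
proof -
  have "closure {x. \<phi> x \<noteq> 0} \<subseteq> C"
    using assms by (intro closure_minimal) (auto intro: compact_imp_closed)
  moreover from this have "compact (closure {x. \<phi> x \<noteq> 0})"
    using compact_Int_closed[OF assms(2) closed_closure, of "{x. \<phi> x \<noteq> 0}"]
    by (simp only: Int_absorb1)
  ultimately show ?thesis
    using assms(1,3) unfolding test_function_def by blast
qed

lemma test_function_eq_0: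
  "test_function U \<phi> \<Longrightarrow> x \<notin> closure {x. \<phi> x \<noteq> 0} \<Longrightarrow> \<phi> x = 0"
  using closure_subset[of "{x. \<phi> x \<noteq> 0}"] by blast

lemma test_function_mult:
  assumes "test_function U \<phi>" "smooth \<psi>"
  shows "test_function U (\<lambda>x. \<phi> x * \<psi> x)"
proof (rule test_functionI)
  show "smooth (\<lambda>x. \<phi> x * \<psi> x)"
    using assms by (intro smooth_mult) (auto simp only: test_function_def)
  show "compact (closure {x. \<phi> x \<noteq> 0})" "closure {x. \<phi> x \<noteq> 0} \<subseteq> U"
    using assms(1) by (simp_all only: test_function_def)
  show "\<phi> x * \<psi> x = 0" if "x \<notin> closure {x. \<phi> x \<noteq> 0}" for x
    using test_function_eq_0[OF assms(1) that] by simp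
qed

lemma test_function_subset: "test_function U \<phi> \<Longrightarrow> U \<subseteq> V \<Longrightarrow> test_function V \<phi>"
  by (auto simp: test_function_def)

text \<open>For each coordinate, two one-sided factors exp(-1/t) facing each other are jointly
  positive exactly when that coordinate of x - z is below r in absolute value. Their product over
  all coordinates is therefore positive exactly on an open cube centred at z.\<close>

lemma bump_exists:
  fixes U :: "'a::euclidean_space set"
  assumes "open U" "z \<in> U"
  shows "\<exists>\<beta>. test_function U \<beta> \<and> (\<forall>x. 0 \<le> \<beta> x) \<and> (\<forall>x. \<beta> x \<le> 1) \<and> \<beta> z > 0"
proof -
  obtain e where e: "e > 0" "cball z e \<subseteq> U" using assms open_contains_cball by blast
  \<comment> \<open>With this half side the l1 norm of x - z is at most e inside the cube, so the
    cube lies in the ball.\<close>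
  define r where "r = e / real DIM('a)"
  have r: "r > 0" using e by (simp add: r_def)
  define \<beta> where "\<beta> x = (\<Prod>b\<in>Basis. flat 1 (r - z \<bullet> b + x \<bullet> b) * flat 1 (r + z \<bullet> b + x \<bullet> (- b)))" for x
  have f01: "0 \<le> flat 1 t" "flat 1 t \<le> 1" for t by (auto simp: flat_def)
  have "test_function U \<beta>"
  proof (rule test_functionI[of _ "cball z e"])
    show "smooth \<beta>"
      unfolding \<beta>_def by (intro smooth_prod smooth_mult smooth_flat)
    fix x assume x: "x \<notin> cball z e"
    have "\<exists>b\<in>Basis. r \<le> \<bar>(x - z) \<bullet> b\<bar>"
    proof (rule ccontr)
      assume "\<not> ?thesis"
      then have "(\<Sum>b\<in>Basis. \<bar>(x - z) \<bullet> b\<bar>) \<le> (\<Sum>b\<in>(Basis::'a set). r)"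
        by (intro sum_mono) force
      also have "\<dots> = e" by (simp add: r_def)
      finally have "norm (x - z) \<le> e" using norm_le_l1[of "x - z"] by linarith
      with x show False by (simp add: dist_norm norm_minus_commute)
    qed
    then obtain b where b: "b \<in> Basis" "r \<le> \<bar>(x - z) \<bullet> b\<bar>" by blast
    then have "flat 1 (r - z \<bullet> b + x \<bullet> b) * flat 1 (r + z \<bullet> b + x \<bullet> (- b)) = 0"
      by (auto simp: flat_def inner_diff_left)
    with b show "\<beta> x = 0" unfolding \<beta>_def by (intro prod_zero) auto
  qed (use e in auto)
  moreover have "0 \<le> \<beta> x" "\<beta> x \<le> 1" for x
    unfolding \<beta>_def by (auto intro!: prod_nonneg prod_le_1 mult_nonneg_nonneg mult_le_one f01)
  moreover have "\<beta> z > 0"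
    using r unfolding \<beta>_def by (intro prod_pos) (auto simp: flat_def)
  ultimately show ?thesis by blast
qed

text \<open>Finitely many bumps are positive on a cover of \<open>K\<close>. The product
  \<open>q\<close> of their complements 1 - \<beta> is below 1 on \<open>K\<close> and equals 1 off
  the supports, so 1 - q^N is a cutoff once N is large.\<close>

lemma cutoff_exists:
  fixes K :: "'a::euclidean_space set"
  assumes "compact K" "open U" "K \<subseteq> U"
  obtains \<psi> where "test_function U \<psi>" "\<And>x. 0 \<le> \<psi> x" "\<And>x. \<psi> x \<le> 1" "\<And>x. x \<in> K \<Longrightarrow> \<psi> x \<ge> 1/2"
proof -
  have "\<exists>\<beta>. test_function U \<beta> \<and> (\<forall>x. 0 \<le> \<beta> x) \<and> (\<forall>x. \<beta> x \<le> 1) \<and> \<beta> z > 0" if "z \<in> K" for z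
    using bump_exists[of U z] assms that by blast
  then obtain \<beta> where \<beta>: "\<And>z. z \<in> K \<Longrightarrow> test_function U (\<beta> z)"
    "\<And>z x. z \<in> K \<Longrightarrow> 0 \<le> \<beta> z x" "\<And>z x. z \<in> K \<Longrightarrow> \<beta> z x \<le> 1" "\<And>z. z \<in> K \<Longrightarrow> \<beta> z z > 0"
    by metis
  have sm: "smooth (\<beta> z)" if "z \<in> K" for z using \<beta>(1)[OF that] by (simp add: test_function_def)
  have "open {x. \<beta> z x > 0}" if "z \<in> K" for z
    using smooth_continuous_on[OF sm[OF that]] by (intro open_Collect_less continuous_intros)
  moreover have "K \<subseteq> (\<Union>z\<in>K. {x. \<beta> z x > 0})" using \<beta>(4) by auto
  ultimately obtain Z where Z: "Z \<subseteq> K" "finite Z" "K \<subseteq> (\<Union>z\<in>Z. {x. \<beta> z x > 0})"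
    by (rule compactE_image[OF assms(1), of K "\<lambda>z. {x. \<beta> z x > 0}"])
  define q where "q x = (\<Prod>z\<in>Z. 1 - \<beta> z x)" for x
  have q01: "0 \<le> q x" "q x \<le> 1" for x
    using \<beta>(2,3) Z(1) unfolding q_def by (auto intro!: prod_nonneg prod_le_1)
  have smq: "smooth q"
    unfolding q_def using sm Z(1) by (intro smooth_prod smooth_diff smooth_const) auto
  have q1: "q x < 1" if x: "x \<in> K" for x
  proof -
    obtain z where z: "z \<in> Z" "\<beta> z x > 0" using Z(3) x by auto
    have "q x = (1 - \<beta> z x) * (\<Prod>z\<in>Z - {z}. 1 - \<beta> z x)"
      unfolding q_def using Z(2) z(1) by (simp add: prod.remove)
    also have "\<dots> \<le> (1 - \<beta> z x) * 1"
      using \<beta>(2,3) Z(1) z(1) by (intro mult_left_mono prod_le_1) auto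
    finally show ?thesis using z(2) by simp
  qed
  have "\<exists>N. \<forall>x\<in>K. q x ^ N \<le> 1/2"
  proof (cases "K = {}")
    case False
    have "continuous_on K q" using smooth_continuous_on[OF smq] continuous_on_subset by blast
    from continuous_attains_sup[OF assms(1) False this]
    obtain y where y: "y \<in> K" "\<And>x. x \<in> K \<Longrightarrow> q x \<le> q y" by blast
    \<comment> \<open>One exponent serves all of \<open>K\<close>, because \<open>q\<close> attains
      a maximum below 1 there.\<close>
    obtain N where "q y ^ N < 1/2"
      using real_arch_pow_inv[of "1/2" "q y", OF _ q1[OF y(1)]] by force
    then have "\<forall>x\<in>K. q x ^ N \<le> 1/2"
      using power_mono[OF y(2) q01(1), of _ N] by fastforce
    then show ?thesis ..
  qed auto
  then obtain N where N: "\<And>x. x \<in> K \<Longrightarrow> q x ^ N \<le> 1/2" by blast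
  define C where "C = (\<Union>z\<in>Z. closure {x. \<beta> z x \<noteq> 0})"
  have "test_function U (\<lambda>x. 1 - q x ^ N)"
  proof (rule test_functionI[of _ C])
    show "compact C" unfolding C_def using \<beta>(1) Z by (intro compact_UN) (auto simp: test_function_def)
    show "C \<subseteq> U" unfolding C_def using \<beta>(1) Z by (auto simp: test_function_def)
    fix x assume "x \<notin> C"
    then have "\<beta> z x = 0" if "z \<in> Z" for z
      using that closure_subset[of "{x. \<beta> z x \<noteq> 0}"] by (auto simp: C_def)
    then show "1 - q x ^ N = 0" by (simp add: q_def)
  qed (intro smooth_diff smooth_const smooth_power smq)
  then show ?thesis
  proof (rule that)
    show "0 \<le> 1 - q x ^ N" "1 - q x ^ N \<le> 1" for x
      using q01[of x] by (simp_all add: power_le_one)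
    show "1/2 \<le> 1 - q x ^ N" if "x \<in> K" for x
      using N[OF that] by simp
  qed
qed

section \<open>Integration by parts\<close>

lemma test_function_partial:
  assumes "test_function U \<phi>" "b \<in> Basis"
  shows "test_function U (\<lambda>x. frechet_derivative \<phi> (at x) b)"
proof (rule test_functionI)
  show "smooth (\<lambda>x. frechet_derivative \<phi> (at x) b)"
    using assms by (intro smooth_partial) (auto simp only: test_function_def)
  show "compact (closure {x. \<phi> x \<noteq> 0})" "closure {x. \<phi> x \<noteq> 0} \<subseteq> U"
    using assms(1) by (simp_all only: test_function_def)
  fix x assume x: "x \<notin> closure {x. \<phi> x \<noteq> 0}"
  have "((\<lambda>x. 0) has_derivative (\<lambda>h. 0)) (at x)" by simp
  then have "(\<phi> has_derivative (\<lambda>h. 0)) (at x)"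
  proof (rule has_derivative_transform_within_open)
    show "open (- closure {x. \<phi> x \<noteq> 0})" by (intro open_Compl closed_closure)
    show "0 = \<phi> y" if "y \<in> - closure {x. \<phi> x \<noteq> 0}" for y
      using test_function_eq_0[OF assms(1), of y] that by simp
  qed (use x in simp)
  from frechet_derivative_at[OF this, symmetric] show "frechet_derivative \<phi> (at x) b = 0"
    by simp
qed

section \<open>Bounds and integrability of test functions\<close>

lemma test_function_smooth: "test_function U \<phi> \<Longrightarrow> smooth \<phi>"
  by (simp only: test_function_def)

lemma test_function_continuous: "test_function U \<phi> \<Longrightarrow> continuous_on UNIV \<phi>"
  by (intro smooth_continuous_on test_function_smooth)

lemma bounded_compact_support:
  fixes f :: "'a::euclidean_space \<Rightarrow> real"
  assumes "continuous_on UNIV f" "compact C" "\<And>x. x \<notin> C \<Longrightarrow> f x = 0"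
  obtains B where "0 < B" "\<And>x. \<bar>f x\<bar> \<le> B"
proof -
  have "bounded (f ` C)"
    using assms by (intro compact_imp_bounded compact_continuous_image) (auto intro: continuous_on_subset)
  then obtain B where B: "B > 0" "\<And>x. x \<in> C \<Longrightarrow> norm (f x) \<le> B"
    unfolding bounded_pos by auto
  have "\<bar>f x\<bar> \<le> B" for x using B assms(3)[of x] by (cases "x \<in> C") auto
  with B that show ?thesis by blast
qed

lemma test_function_bounded:
  assumes "test_function U \<phi>"
  obtains B where "0 < B" "\<And>x. \<bar>\<phi> x\<bar> \<le> B"
proof (rule bounded_compact_support)
  show "continuous_on UNIV \<phi>" using assms by (rule test_function_continuous)
  show "compact (closure {x. \<phi> x \<noteq> 0})" using assms by (simp only: test_function_def)
  show "\<phi> x = 0" if "x \<notin> closure {x. \<phi> x \<noteq> 0}" for x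
    using assms that by (rule test_function_eq_0)
qed (use that in blast)

lemma integrable_compact_support:
  fixes f :: "'a::euclidean_space \<Rightarrow> real"
  assumes "continuous_on UNIV f" "compact C" "\<And>x. x \<notin> C \<Longrightarrow> f x = 0"
  shows "integrable lborel f"
proof -
  have "integrable lborel (\<lambda>x. indicator C x *\<^sub>R f x)"
    using assms by (intro borel_integrable_compact) (auto intro: continuous_on_subset)
  moreover have "(\<lambda>x. indicator C x *\<^sub>R f x) = f"
    using assms(3) by (auto simp: indicator_def fun_eq_iff)
  ultimately show ?thesis by simp
qed

lemma test_function_integrable:
  assumes "test_function U \<phi>"
  shows "integrable lborel \<phi>" "integrable lebesgue \<phi>"
proof -
  show "integrable lborel \<phi>"
  proof (rule integrable_compact_support)
    show "continuous_on UNIV \<phi>" using assms by (rule test_function_continuous)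
    show "compact (closure {x. \<phi> x \<noteq> 0})" using assms by (simp only: test_function_def)
    show "\<phi> x = 0" if "x \<notin> closure {x. \<phi> x \<noteq> 0}" for x
      using assms that by (rule test_function_eq_0)
  qed
  then show "integrable lebesgue \<phi>"
    by (simp add: integrable_completion)
qed

lemma lborel_integral_translate:
  fixes f :: "'a::euclidean_space \<Rightarrow> real"
  assumes "f \<in> borel_measurable borel"
  shows "(LINT x|lborel. f (c + x)) = (LINT x|lborel. f x)"
proof -
  have "(LINT x|lborel. f x) = (LINT x|distr lborel borel ((+) c). f x)"
    by (simp add: lborel_distr_plus)
  also have "\<dots> = (LINT x|lborel. f (c + x))"
    by (rule integral_distr) (use assms in auto)
  finally show ?thesis by simp
qed

lemma smooth_line_derivative:
  assumes "smooth u"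
  shows "((\<lambda>t. u (x + t *\<^sub>R b)) has_field_derivative
    frechet_derivative u (at (x + t *\<^sub>R b)) b) (at t)"
proof -
  have "((\<lambda>t. x + t *\<^sub>R b) has_derivative (\<lambda>h. h *\<^sub>R b)) (at t)"
    by (auto intro!: derivative_eq_intros)
  from has_derivative_compose[OF this smooth_has_derivative[OF assms]]
  have "((\<lambda>t. u (x + t *\<^sub>R b)) has_derivative
    (\<lambda>h. frechet_derivative u (at (x + t *\<^sub>R b)) (h *\<^sub>R b))) (at t)" .
  moreover have "linear (frechet_derivative u (at (x + t *\<^sub>R b)))"
    using smooth_has_derivative[OF assms] has_derivative_linear by blast
  ultimately show ?thesis
    by (simp add: has_field_derivative_def linear_cmul mult_commute_abs)
qed

text \<open>By translation invariance the difference quotients have integral zero.\<close>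

lemma integral_partial_eq_0:
  assumes u: "test_function UNIV u" and b: "b \<in> Basis"
  shows "(LINT x|lebesgue. frechet_derivative u (at x) b) = 0"
proof -
  define u' where "u' x = frechet_derivative u (at x) b" for x
  define C where "C = closure {x. u x \<noteq> 0}"
  \<comment> \<open>The steps have length at most 1, so \<open>C'\<close> carries all difference
    quotients \<open>s n\<close> at once, and the indicator of \<open>C'\<close> times
    \<open>B\<close> is an integrable majorant.\<close>
  define C' where "C' = {x - y |x y. x \<in> C \<and> y \<in> cball 0 1}"
  define s where "s n x = (u (inverse (real (Suc n)) *\<^sub>R b + x) - u x) / inverse (real (Suc n))" for n x
  have C: "compact C" unfolding C_def using u by (simp only: test_function_def)
  then have C': "compact C'" unfolding C'_def by (intro compact_differences) auto
  have u': "test_function UNIV u'"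
    unfolding u'_def using u b by (rule test_function_partial)
  obtain B where B: "0 < B" "\<And>x. \<bar>u' x\<bar> \<le> B" using test_function_bounded[OF u'] by blast
  have meas: "u \<in> borel_measurable borel" "u' \<in> borel_measurable borel"
    using test_function_continuous[OF u] test_function_continuous[OF u']
    by (auto intro: borel_measurable_continuous_onI)
  have int_s: "(LINT x|lborel. s n x) = 0" for n
  proof -
    have shift: "integrable lborel (\<lambda>x. u (c + x))" for c
    proof -
      have "integrable (distr lborel borel ((+) c)) u"
        using test_function_integrable(1)[OF u] by (simp add: lborel_distr_plus)
      then show ?thesis by (subst (asm) integrable_distr_eq) (use meas in auto)
    qed
    show ?thesis
      unfolding s_def integral_divide_zero
      by (subst Bochner_Integration.integral_diff)
         (use shift test_function_integrable(1)[OF u] lborel_integral_translate[OF meas(1)] in auto)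
  qed
  have lim: "(\<lambda>n. s n x) \<longlonglongrightarrow> u' x" for x
  proof -
    have "((\<lambda>h. (u (x + h *\<^sub>R b) - u x) / h) \<longlongrightarrow> u' x) (at 0)"
      using smooth_line_derivative[OF test_function_smooth[OF u], of x b 0]
      by (simp add: DERIV_def u'_def)
    moreover have "filterlim (\<lambda>n. inverse (real (Suc n))) (at 0) sequentially"
      using LIMSEQ_inverse_real_of_nat by (auto simp: filterlim_at)
    ultimately have "(\<lambda>n. (u (x + inverse (real (Suc n)) *\<^sub>R b) - u x) / inverse (real (Suc n))) \<longlonglongrightarrow> u' x"
      by (rule filterlim_compose)
    then show ?thesis by (simp add: s_def add.commute)
  qed
  have bound: "norm (s n x) \<le> indicator C' x * B" for n x
  proof (cases "x \<in> C'")
    case True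
    define d where "d = inverse (real (Suc n))"
    have d: "d > 0" by (simp add: d_def)
    \<comment> \<open>By the mean value theorem on the segment the quotient is a value of
      \<open>u'\<close>, hence bounded by \<open>B\<close>.\<close>
    obtain z where "u (x + d *\<^sub>R b) - u (x + 0 *\<^sub>R b) = (d - 0) * u' (x + z *\<^sub>R b)"
      using MVT2[OF d, of "\<lambda>t. u (x + t *\<^sub>R b)" "\<lambda>t. u' (x + t *\<^sub>R b)"]
        smooth_line_derivative[OF test_function_smooth[OF u], of x b] unfolding u'_def by blast
    moreover have "s n x = (u (x + d *\<^sub>R b) - u x) / d"
      unfolding s_def d_def by (simp only: add.commute)
    ultimately have "s n x = u' (x + z *\<^sub>R b)"
      using d by simp
    with True B show ?thesis by simp
  next
    case False
    define d where "d = inverse (real (Suc n))"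
    have d: "norm (d *\<^sub>R b) \<le> 1" using b by (simp add: d_def inverse_le_1_iff)
    have "d *\<^sub>R b + x \<notin> C"
    proof
      assume "d *\<^sub>R b + x \<in> C"
      with d have "(d *\<^sub>R b + x) - d *\<^sub>R b \<in> C'" unfolding C'_def by fastforce
      with False show False by simp
    qed
    moreover have "x \<notin> C"
    proof
      assume "x \<in> C"
      then have "x - 0 \<in> C'" unfolding C'_def by fastforce
      with False show False by simp
    qed
    ultimately have "u (d *\<^sub>R b + x) = 0" "u x = 0"
      using test_function_eq_0[OF u] unfolding C_def by blast+
    with False show ?thesis by (simp add: s_def d_def)
  qed
  have "(\<lambda>n. LINT x|lborel. s n x) \<longlonglongrightarrow> (LINT x|lborel. u' x)"
  proof (rule integral_dominated_convergence)
    show "integrable lborel (\<lambda>x. indicator C' x * B)"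
      using borel_integrable_compact[OF C', of "\<lambda>x. B"] by simp
    show "u' \<in> borel_measurable lborel" "s n \<in> borel_measurable lborel" for n
      using meas unfolding s_def by measurable
    show "AE x in lborel. (\<lambda>n. s n x) \<longlonglongrightarrow> u' x" by (intro AE_I2 lim)
    show "AE x in lborel. norm (s n x) \<le> indicator C' x * B" for n by (intro AE_I2 bound)
  qed
  then have "(LINT x|lborel. u' x) = 0"
    by (simp add: int_s LIMSEQ_const_iff)
  then show ?thesis
    using meas unfolding u'_def[symmetric] by (simp add: integral_completion)
qed

text \<open>The product of \<phi> and the merely smooth \<open>v\<close> is again a test function,
  so the integral of its partial derivative vanishes; the product rule splits it into the two
  sides.\<close>

lemma integral_by_parts:
  assumes \<phi>: "test_function UNIV \<phi>" and v: "smooth v" and b: "b \<in> Basis"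
  shows "(LINT x|lebesgue. v x * frechet_derivative \<phi> (at x) b) =
    - (LINT x|lebesgue. frechet_derivative v (at x) b * \<phi> x)"
proof -
  have "((\<lambda>x. \<phi> x * v x) has_derivative
      (\<lambda>h. \<phi> x * frechet_derivative v (at x) h + frechet_derivative \<phi> (at x) h * v x)) (at x)" for x
    using v test_function_smooth[OF \<phi>] by (intro has_derivative_mult smooth_has_derivative)
  then have "frechet_derivative (\<lambda>x. \<phi> x * v x) (at x) b =
      frechet_derivative v (at x) b * \<phi> x + v x * frechet_derivative \<phi> (at x) b" for x
    by (subst frechet_derivative_at[symmetric]) (auto simp: mult.commute)
  then have "0 = (LINT x|lebesgue. frechet_derivative v (at x) b * \<phi> x + v x * frechet_derivative \<phi> (at x) b)"
    using integral_partial_eq_0[OF test_function_mult[OF \<phi> v] b] by simp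
  also have "\<dots> = (LINT x|lebesgue. frechet_derivative v (at x) b * \<phi> x) +
      (LINT x|lebesgue. v x * frechet_derivative \<phi> (at x) b)"
  proof (rule Bochner_Integration.integral_add)
    show "integrable lebesgue (\<lambda>x. frechet_derivative v (at x) b * \<phi> x)"
      using test_function_integrable(2)[OF test_function_mult[OF \<phi> smooth_partial[OF v b]]]
      by (simp add: mult.commute)
    show "integrable lebesgue (\<lambda>x. v x * frechet_derivative \<phi> (at x) b)"
      using test_function_integrable(2)[OF test_function_mult[OF test_function_partial[OF \<phi> b] v]]
      by (simp add: mult.commute)
  qed
  finally show ?thesis by simp
qed

section \<open>Locally finite series off a closed set\<close>

lemma integrable_lebesgue_on:
  fixes f :: "'a::euclidean_space \<Rightarrow> real"
  assumes "integrable lebesgue f" "S \<in> sets lebesgue"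
  shows "integrable (lebesgue_on S) f"
  using assms integrable_mult_indicator[OF assms(2,1)] by (subst integrable_restrict_space) auto

lemma continuous_integrable_lebesgue_on_compact:
  fixes f :: "'a::euclidean_space \<Rightarrow> real"
  assumes "continuous_on UNIV f" "compact C"
  shows "integrable (lebesgue_on C) f"
proof -
  have "integrable lborel (\<lambda>x. indicator C x *\<^sub>R f x)"
    using assms by (intro borel_integrable_compact) (auto intro: continuous_on_subset)
  then have "integrable lebesgue (\<lambda>x. indicator C x *\<^sub>R f x)"
    by (simp add: integrable_completion)
  then show ?thesis
    using assms(2) by (subst integrable_restrict_space) (auto dest: lmeasurable_compact)
qed

lemma frechet_derivative_sum:
  fixes f :: "'i \<Rightarrow> 'a::euclidean_space \<Rightarrow> real"
  assumes "\<And>i. i \<in> I \<Longrightarrow> smooth (f i)"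
  shows "frechet_derivative (\<lambda>x. \<Sum>i\<in>I. f i x) (at x) = (\<lambda>h. \<Sum>i\<in>I. frechet_derivative (f i) (at x) h)"
  by (rule frechet_derivative_at[symmetric]) (intro has_derivative_sum smooth_has_derivative assms)

lemma suminf_initial:
  fixes f :: "nat \<Rightarrow> real"
  assumes "\<And>k. k \<ge> N \<Longrightarrow> f k = 0"
  shows "(\<Sum>k. f k) = (\<Sum>k<N. f k)"
  using assms by (intro suminf_finite) auto

text \<open>Continuity comes from the Weierstrass test. On a compact set missing \<open>K\<close>
  the series is a finite sum, so its weak derivatives are the termwise ones. Their q-th powers are
  dominated by a series over the sets \<open>U k - K\<close> whose integrals are controlled by
  \<open>meas\<close>.\<close>

lemma sobolev_series:
  fixes U :: "nat \<Rightarrow> 'a::euclidean_space set" and f :: "nat \<Rightarrow> 'a \<Rightarrow> real" and q :: real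
  assumes K: "closed K" and D: "compact D" "\<And>k. U k \<subseteq> D"
    and U: "\<And>k. open (U k)"
    and locfin: "\<And>C. compact C \<Longrightarrow> C \<inter> K = {} \<Longrightarrow> \<exists>N. \<forall>k\<ge>N. U k \<inter> C = {}"
    and f: "\<And>k. test_function (U k) (f k)"
    and f_le: "\<And>k x. \<bar>f k x\<bar> \<le> (1/2) ^ k"
    and df_le: "\<And>k x b. b \<in> Basis \<Longrightarrow> \<bar>frechet_derivative (f k) (at x) b\<bar> \<le> L k"
    and q: "1 \<le> q"
    and meas: "\<And>k. (\<Sum>j\<le>k. L j) powr q * measure lebesgue (U k - K) \<le> (1/2) ^ k"
  shows "continuous_on UNIV (\<lambda>x. \<Sum>k. f k x)" "(\<lambda>x. \<Sum>k. f k x) \<in> W1p (ereal q) (- K)"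
proof -
  define F where "F x = (\<Sum>k. f k x)" for x
  define g where "g b x = (\<Sum>k. frechet_derivative (f k) (at x) b)" for b x
  have L0: "0 \<le> L k" for k
    using df_le[of _ k 0] SOME_Basis abs_ge_zero order_trans by blast
  have K_leb: "- K \<in> sets lebesgue" using K by (simp add: borel_closed)
  have smf: "smooth (f k)" for k using f by (rule test_function_smooth)
  have f0: "f k x = 0" if "x \<notin> U k" for k x
    using f[of k] that test_function_eq_0[OF f, of x k] unfolding test_function_def by blast
  have df0: "frechet_derivative (f k) (at x) b = 0" if "x \<notin> U k" "b \<in> Basis" for k x b
    using test_function_partial[OF f[of k] that(2)] that
      test_function_eq_0[OF test_function_partial[OF f that(2)], of x k]
    unfolding test_function_def by blast
  have cont_df: "continuous_on UNIV (\<lambda>x. frechet_derivative (f k) (at x) b)" if "b \<in> Basis" for k b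
    using smooth_partial[OF smf that] by (rule smooth_continuous_on)
  have "uniform_limit UNIV (\<lambda>n x. \<Sum>i<n. f i x) (\<lambda>x. \<Sum>i. f i x) sequentially"
    using f_le by (intro Weierstrass_m_test[where M = "\<lambda>k. (1/2)^k"]) (auto simp: summable_geometric)
  then have contF: "continuous_on UNIV F"
    unfolding F_def
    by (rule uniform_limit_theorem[rotated])
       (auto intro!: smooth_continuous_on smooth_sum smf always_eventually)
  then show "continuous_on UNIV (\<lambda>x. \<Sum>k. f k x)" by (simp add: F_def)
  have F0: "F x = 0" if "x \<notin> D" for x
  proof -
    have "f k x = 0" for k using f0[of x k] D(2)[of k] that by blast
    then show ?thesis by (simp add: F_def)
  qed
  have local: "\<exists>N. \<forall>x\<in>C. (\<forall>k\<ge>N. x \<notin> U k) \<and> F x = (\<Sum>k<N. f k x) \<and>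
      (\<forall>b\<in>Basis. g b x = (\<Sum>k<N. frechet_derivative (f k) (at x) b))"
    if C: "compact C" "C \<inter> K = {}" for C
  proof -
    obtain N where "\<And>k. k \<ge> N \<Longrightarrow> U k \<inter> C = {}" using locfin[OF C] by blast
    then have N: "x \<notin> U k" if "k \<ge> N" "x \<in> C" for k x using that by blast
    have "F x = (\<Sum>k<N. f k x)" if "x \<in> C" for x
      unfolding F_def using N[OF _ that] f0 by (intro suminf_initial) auto
    moreover have "g b x = (\<Sum>k<N. frechet_derivative (f k) (at x) b)" if "x \<in> C" "b \<in> Basis" for x b
      unfolding g_def using N[OF _ that(1)] df0[OF _ that(2)] by (intro suminf_initial) auto
    ultimately show ?thesis using N by blast
  qed
  have F_Lp: "F \<in> Lp (ereal q) (- K)"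
  proof -
    have "integrable lborel (\<lambda>x. \<bar>F x\<bar> powr q)"
    proof (rule integrable_compact_support)
      show "continuous_on UNIV (\<lambda>x. \<bar>F x\<bar> powr q)"
        using q by (intro continuous_on_powr' continuous_intros contF) auto
    qed (use D(1) F0 in auto)
    then have "integrable lebesgue (\<lambda>x. \<bar>F x\<bar> powr q)"
      by (simp add: integrable_completion)
    moreover have "F \<in> borel_measurable lebesgue"
      using borel_measurable_continuous_onI[OF contF] by (simp add: measurable_completion)
    ultimately show ?thesis
      using K_leb by (auto simp: Lp_def intro!: integrable_lebesgue_on measurable_restrict_space1)
  qed
  define S where "S k = (\<Sum>j\<le>k. L j)" for k
  \<comment> \<open>The majorant of \<open>\<bar>g b x\<bar> powr q\<close> off \<open>K\<close>;
    its terms have integrals at most (1/2)^k. On \<open>K\<close> every term is 0.\<close>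
  define h where "h x = (\<Sum>k. S k powr q * indicator (U k - K) x)" for x
  have point: "\<exists>N. (\<forall>k\<ge>N. x \<notin> U k) \<and> (\<forall>b\<in>Basis. g b x = (\<Sum>k<N. frechet_derivative (f k) (at x) b))"
    if "x \<notin> K" for x
    using local[of "{x}"] that by auto
  have summ: "summable (\<lambda>k. S k powr q * indicator (U k - K) x)" for x
  proof (cases "x \<in> K")
    case False
    then obtain N where "\<And>k. k \<ge> N \<Longrightarrow> x \<notin> U k" using point[of x] by blast
    then show ?thesis
      by (intro summable_finite[of "{..<N}"]) (auto simp: indicator_def)
  qed auto
  have h_int: "integrable lebesgue h"
    unfolding h_def
  proof (rule integrable_suminf)
    have UK: "U k - K \<in> lmeasurable" for k
    proof (rule bounded_set_imp_lmeasurable)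
      show "bounded (U k - K)" using D by (meson Diff_subset bounded_subset compact_imp_bounded)
      show "U k - K \<in> sets lebesgue" using U[of k] K by (intro sets.Diff) (auto simp: borel_closed)
    qed
    then show int: "integrable lebesgue (\<lambda>x. S k powr q * indicator (U k - K) x)" for k
      unfolding lmeasurable_iff_integrable by (intro integrable_mult_right)
    have "(LINT x|lebesgue. norm (S k powr q * indicator (U k - K) x)) = S k powr q * measure lebesgue (U k - K)" for k
      by (simp add: abs_mult)
    then show "summable (\<lambda>k. LINT x|lebesgue. norm (S k powr q * indicator (U k - K) x))"
      using meas by (intro summable_comparison_test'[OF summable_geometric[of "1/2::real"]])
        (auto simp: S_def)
    show "AE x in lebesgue. summable (\<lambda>k. norm (S k powr q * indicator (U k - K) x))"
      using summ by (auto simp: abs_mult)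
  qed
  have h_nonneg: "0 \<le> h x" for x
    unfolding h_def using summ by (intro suminf_nonneg) auto
  have g_le: "\<bar>g b x\<bar> powr q \<le> h x" if x: "x \<notin> K" and b: "b \<in> Basis" for b x
  proof -
    obtain N where N: "\<And>k. k \<ge> N \<Longrightarrow> x \<notin> U k"
      and gN: "g b x = (\<Sum>k<N. frechet_derivative (f k) (at x) b)"
      using point[OF x] b by metis
    \<comment> \<open>The \<open>U k\<close> are not assumed nested, so the indices active at
      \<open>x\<close> may have gaps. Since \<open>L\<close> is nonnegative, their sum is still at
      most \<open>S m\<close> for the largest active index \<open>m\<close>, and \<open>x\<close>
      lies in \<open>U m - K\<close>.\<close>
    define J where "J = {k. x \<in> U k}"
    have "J \<subseteq> {..<N}"
    proof
      show "k \<in> {..<N}" if "k \<in> J" for k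
        using N[of k] that by (cases "k < N") (auto simp: J_def)
    qed
    then have J: "finite J" using finite_subset by blast
    have gJ: "g b x = (\<Sum>k\<in>J. frechet_derivative (f k) (at x) b)"
      unfolding gN using \<open>J \<subseteq> {..<N}\<close> df0[OF _ b]
      by (intro sum.mono_neutral_right) (auto simp: J_def)
    show ?thesis
    proof (cases "J = {}")
      case True
      with gJ h_nonneg show ?thesis by simp
    next
      case False
      define m where "m = Max J"
      have m: "m \<in> J" "J \<subseteq> {..m}" using J False unfolding m_def by auto
      have "\<bar>g b x\<bar> \<le> (\<Sum>k\<in>J. L k)"
        unfolding gJ using df_le[OF b] by (intro order_trans[OF sum_abs] sum_mono)
      also have "\<dots> \<le> S m"
        unfolding S_def using m(2) L0 by (intro sum_mono2) auto
      finally have "\<bar>g b x\<bar> powr q \<le> S m powr q"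
        using q by (intro powr_mono2) auto
      also have "\<dots> = (\<Sum>k\<in>{m}. S k powr q * indicator (U k - K) x)"
        using m(1) x by (simp add: J_def)
      also have "\<dots> \<le> h x"
        unfolding h_def using summ by (intro sum_le_suminf) auto
      finally show ?thesis .
    qed
  qed
  have g_meas: "g b \<in> borel_measurable lebesgue" if "b \<in> Basis" for b
  proof -
    have "g b \<in> borel_measurable borel"
      unfolding g_def using cont_df[OF that]
      by (intro borel_measurable_suminf borel_measurable_continuous_onI)
    then show ?thesis by (simp add: measurable_completion)
  qed
  have g_Lp: "g b \<in> Lp (ereal q) (- K)" if b: "b \<in> Basis" for b
  proof -
    have meas: "g b \<in> borel_measurable (lebesgue_on (- K))"
      using g_meas[OF b] by (rule measurable_restrict_space1)
    have "integrable (lebesgue_on (- K)) (\<lambda>x. \<bar>g b x\<bar> powr q)"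
    proof (rule Bochner_Integration.integrable_bound)
      show "integrable (lebesgue_on (- K)) h" using h_int K_leb by (rule integrable_lebesgue_on)
      show "(\<lambda>x. \<bar>g b x\<bar> powr q) \<in> borel_measurable (lebesgue_on (- K))"
        using meas by measurable
      show "AE x in lebesgue_on (- K). norm (\<bar>g b x\<bar> powr q) \<le> norm (h x)"
        using g_le[OF _ b] h_nonneg by (intro AE_I2) (auto simp: space_restrict_space)
    qed
    with meas show ?thesis by (simp add: Lp_def)
  qed
  have wd: "weak_partial_derivative (- K) b F (g b)" if b: "b \<in> Basis" for b
    unfolding weak_partial_derivative_def
  proof (intro conjI allI impI)
    show "locally_integrable (- K) F"
      unfolding locally_integrable_def
      using continuous_integrable_lebesgue_on_compact[OF contF] by blast
    show "locally_integrable (- K) (g b)"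
      unfolding locally_integrable_def
    proof (intro allI impI)
      fix C :: "'a set" assume C: "compact C \<and> C \<subseteq> - K"
      then obtain N where N: "\<And>x. x \<in> C \<Longrightarrow> g b x = (\<Sum>k<N. frechet_derivative (f k) (at x) b)"
        using local[of C] b by blast
      have "integrable (lebesgue_on C) (\<lambda>x. \<Sum>k<N. frechet_derivative (f k) (at x) b)"
        using cont_df[OF b] C by (intro continuous_integrable_lebesgue_on_compact continuous_on_sum) auto
      then show "integrable (lebesgue_on C) (g b)"
        by (rule Bochner_Integration.integrable_cong[THEN iffD1, rotated 2])
           (use N in \<open>auto simp: space_restrict_space\<close>)
    qed
    fix \<phi> assume \<phi>: "test_function (- K) \<phi>"
    \<comment> \<open>The support of \<phi> is a compact set missing \<open>K\<close>. There the
      series equals the finite sum \<open>v\<close>, which is smooth on the whole space, so the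
      classical formula applies to \<open>v\<close>.\<close>
    define C where "C = closure {x. \<phi> x \<noteq> 0}"
    have C: "compact C" "C \<inter> K = {}" using \<phi> unfolding C_def test_function_def by blast+
    obtain N where N: "\<And>x. x \<in> C \<Longrightarrow> F x = (\<Sum>k<N. f k x)"
      "\<And>x. x \<in> C \<Longrightarrow> g b x = (\<Sum>k<N. frechet_derivative (f k) (at x) b)"
      using local[OF C] b by blast
    define v where "v x = (\<Sum>k<N. f k x)" for x
    have v: "smooth v" unfolding v_def using smf by (intro smooth_sum)
    have dv: "frechet_derivative v (at x) b = (\<Sum>k<N. frechet_derivative (f k) (at x) b)" for x
      unfolding v_def using smf by (simp add: frechet_derivative_sum)
    have \<phi>0: "\<phi> x = 0" "frechet_derivative \<phi> (at x) b = 0" if "x \<notin> C" for x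
    proof -
      show "\<phi> x = 0" using that unfolding C_def by (rule test_function_eq_0[OF \<phi>])
      have "test_function C \<phi>" using \<phi> unfolding C_def test_function_def by blast
      from test_function_partial[OF this b] test_function_eq_0[OF test_function_partial[OF this b]] that
      show "frechet_derivative \<phi> (at x) b = 0" unfolding test_function_def by blast
    qed
    have CK: "x \<in> - K" if "x \<in> C" for x using C(2) that by blast
    have 1: "indicator (- K) x *\<^sub>R (F x * frechet_derivative \<phi> (at x) b) = v x * frechet_derivative \<phi> (at x) b" for x
      using N(1)[of x] \<phi>0(2)[of x] CK[of x] by (cases "x \<in> C") (auto simp: v_def)
    have 2: "indicator (- K) x *\<^sub>R (g b x * \<phi> x) = frechet_derivative v (at x) b * \<phi> x" for x
      using N(2)[of x] \<phi>0(1)[of x] CK[of x] by (cases "x \<in> C") (auto simp: dv)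
    show "(LINT x|lebesgue_on (- K). F x * frechet_derivative \<phi> (at x) b) =
        - (LINT x|lebesgue_on (- K). g b x * \<phi> x)"
      using K_leb integral_by_parts[OF test_function_subset[OF \<phi> subset_UNIV] v b]
      by (simp add: integral_restrict_space 1 2 del: real_scaleR_def)
  qed
  show "(\<lambda>x. \<Sum>k. f k x) \<in> W1p (ereal q) (- K)"
    using F_Lp g_Lp wd unfolding W1p_def F_def[symmetric] by blast
qed

section \<open>Series without a weak derivative\<close>

lemma test_function_compact_support:
  assumes "test_function C \<phi>" "x \<notin> C"
  shows "\<phi> x = 0"
  using assms test_function_eq_0[OF assms(1), of x] unfolding test_function_def by blast

text \<open>Pairing the series with the derivative of \<open>\<phi> k\<close> gives at least -I by
  the weak derivative. Integration by parts on the first \<open>k + 1\<close> terms, with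
  \<open>low\<close> for the last of them, gives at most 2V - k once the tail is added. So k is at
  most I + 2V for every k, which is absurd. Since \<open>C\<close> is compact rather than open,
  \<open>test_function C\<close> just records that the support lies in \<open>C\<close>.\<close>

lemma not_weakly_differentiable_series:
  fixes f \<phi> :: "nat \<Rightarrow> 'a::euclidean_space \<Rightarrow> real"
  assumes C: "compact C" and b: "b \<in> Basis"
    and f: "\<And>k. test_function C (f k)" and \<phi>: "\<And>k. test_function C (\<phi> k)"
    and f_le: "\<And>k x. \<bar>f k x\<bar> \<le> (1/2) ^ k"
    and df_le: "\<And>k x. \<bar>frechet_derivative (f k) (at x) b\<bar> \<le> L k"
    and \<phi>_le: "\<And>k x. \<bar>\<phi> k x\<bar> \<le> 1"
    and tail: "\<And>j k x. k < j \<Longrightarrow> \<bar>f j x * frechet_derivative (\<phi> k) (at x) b\<bar> \<le> (1/2) ^ j"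
    and low: "\<And>k. real k + measure lebesgue C * (\<Sum>j<k. L j) - measure lebesgue C
      \<le> (LINT x|lebesgue. frechet_derivative (f k) (at x) b * \<phi> k x)"
  shows "\<not> weak_partial_derivative UNIV b (\<lambda>x. \<Sum>k. f k x) g"
proof
  assume weak: "weak_partial_derivative UNIV b (\<lambda>x. \<Sum>k. f k x) g"
  define F where "F x = (\<Sum>k. f k x)" for x
  define V where "V = measure lebesgue C"
  \<comment> \<open>Finite by local integrability, independent of \<open>k\<close>, and a bound for
    every pairing of \<open>g\<close> with \<open>\<phi> k\<close>, as these functions are at most 1
    in size and supported in \<open>C\<close>.\<close>
  define I where "I = (LINT x|lebesgue. indicator C x * \<bar>g x\<bar>)"
  have C_leb: "C \<in> lmeasurable" using C by (rule lmeasurable_compact)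
  have int_C: "integrable lebesgue (\<lambda>x. indicator C x * c)" for c :: real
    using C_leb unfolding lmeasurable_iff_integrable by (intro integrable_mult_left)
  have smf: "smooth (f k)" and sm\<phi>: "smooth (\<phi> k)" for k
    using f \<phi> by (auto intro: test_function_smooth)
  have int_g: "integrable lebesgue (\<lambda>x. indicator C x * g x)"
  proof -
    have "integrable (lebesgue_on C) g"
      using weak C unfolding weak_partial_derivative_def locally_integrable_def by blast
    then show ?thesis using C_leb by (subst (asm) integrable_restrict_space) auto
  qed
  have "real k \<le> I + 2 * V" for k
  proof -
    define d where "d x = frechet_derivative (\<phi> k) (at x) b" for x
    define v where "v x = (\<Sum>j\<le>k. f j x)" for x
    have d: "test_function C d" unfolding d_def using \<phi> b by (rule test_function_partial)
    have \<phi>U: "test_function UNIV (\<phi> k)" using \<phi> by (rule test_function_subset) simp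
    have v: "smooth v" unfolding v_def using smf by (intro smooth_sum)
    have dv: "frechet_derivative v (at x) b = (\<Sum>j\<le>k. frechet_derivative (f j) (at x) b)" for x
      unfolding v_def using smf by (simp add: frechet_derivative_sum)
    \<comment> \<open>Only the terms with index above \<open>k\<close> remain. By
      \<open>tail\<close> they sum to at most 2 (1/2)^(k+1), hence at most 1, and they vanish off
      \<open>C\<close>.\<close>
    have rest: "\<bar>F x * d x - v x * d x\<bar> \<le> indicator C x * 1" for x
    proof (cases "x \<in> C")
      case True
      have summ: "summable (\<lambda>j. f j x)"
        using f_le by (intro summable_comparison_test'[OF summable_geometric[of "1/2::real"]]) auto
      have geo: "(\<lambda>j. (1/2) ^ (j + Suc k) :: real) sums (2 * (1/2) ^ Suc k)"
        using sums_mult2[OF geometric_sums[of "1/2::real"], of "(1/2) ^ Suc k"]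
        by (simp add: power_add)
      have "F x = (\<Sum>j. f (j + Suc k) x) + v x"
        using suminf_split_initial_segment[OF summ, of "Suc k"] by (simp add: F_def v_def lessThan_Suc_atMost)
      then have "F x * d x - v x * d x = (\<Sum>j. f (j + Suc k) x * d x)"
        using suminf_mult2[OF summable_ignore_initial_segment[OF summ, of "Suc k"], of "d x"]
        by (simp add: algebra_simps)
      also have "\<bar>\<dots>\<bar> \<le> (\<Sum>j. (1/2) ^ (j + Suc k))"
      proof -
        have le: "norm (f (j + Suc k) x * d x) \<le> (1/2) ^ (j + Suc k)" for j
          using tail[of k "j + Suc k" x] by (simp add: d_def)
        have "summable (\<lambda>j. norm (f (j + Suc k) x * d x))"
          using le by (intro summable_comparison_test'[OF sums_summable[OF geo]]) auto
        from summable_norm[OF this] suminf_le[OF le this sums_summable[OF geo]]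
        show ?thesis by simp
      qed
      also have "\<dots> = 2 * (1/2) ^ Suc k" using geo by (rule sums_unique[symmetric])
      also have "\<dots> \<le> 1" by (simp add: power_le_one)
      finally show ?thesis using True by simp
    next
      case False
      then show ?thesis using test_function_compact_support[OF d False] by simp
    qed
    have int_vd: "integrable lebesgue (\<lambda>x. v x * d x)"
      using test_function_integrable(2)[OF test_function_mult[OF d v]] by (simp add: mult.commute)
    have F_meas: "F \<in> borel_measurable lebesgue"
    proof -
      have "F \<in> borel_measurable borel"
        unfolding F_def using smooth_continuous_on[OF smf]
        by (intro borel_measurable_suminf borel_measurable_continuous_onI)
      then show ?thesis by (simp add: measurable_completion)
    qed
    have d_meas: "d \<in> borel_measurable lebesgue" "\<phi> k \<in> borel_measurable lebesgue"
      using test_function_integrable(2)[OF d] test_function_integrable(2)[OF \<phi>] by auto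
    have int_rest: "integrable lebesgue (\<lambda>x. F x * d x - v x * d x)"
    proof (rule Bochner_Integration.integrable_bound[OF int_C[of 1]])
      show "(\<lambda>x. F x * d x - v x * d x) \<in> borel_measurable lebesgue"
        by (intro borel_measurable_diff borel_measurable_times[OF F_meas d_meas(1)]
            borel_measurable_integrable[OF int_vd])
      show "AE x in lebesgue. norm (F x * d x - v x * d x) \<le> norm (indicator C x * 1 :: real)"
        using rest by (intro AE_I2) auto
    qed
    have rest_V: "\<bar>LINT x|lebesgue. F x * d x - v x * d x\<bar> \<le> V"
      using integral_abs_bound_integral[OF int_rest int_C[of 1] rest] C_leb by (simp add: V_def)
    have int_g\<phi>: "integrable lebesgue (\<lambda>x. g x * \<phi> k x)"
      and g\<phi>_le: "\<bar>g x * \<phi> k x\<bar> \<le> indicator C x * \<bar>g x\<bar>" for x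
    proof -
      show le: "\<bar>g x * \<phi> k x\<bar> \<le> indicator C x * \<bar>g x\<bar>" for x
        using \<phi>_le[of k x] test_function_compact_support[OF \<phi>, of x k]
        by (cases "x \<in> C") (auto simp: abs_mult mult_left_le)
      have eq: "(\<lambda>x. g x * \<phi> k x) = (\<lambda>x. (indicator C x * g x) * \<phi> k x)"
        using test_function_compact_support[OF \<phi>] by (auto simp: indicator_def fun_eq_iff)
      show "integrable lebesgue (\<lambda>x. g x * \<phi> k x)"
      proof (rule Bochner_Integration.integrable_bound[OF int_g])
        show "(\<lambda>x. g x * \<phi> k x) \<in> borel_measurable lebesgue"
          unfolding eq by (intro borel_measurable_times[OF borel_measurable_integrable[OF int_g] d_meas(2)])
        show "AE x in lebesgue. norm (g x * \<phi> k x) \<le> norm (indicator C x * g x)"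
          using le by (intro AE_I2) (auto simp: abs_mult)
      qed
    qed
    have "integrable lebesgue (\<lambda>x. indicator C x * \<bar>g x\<bar>)"
      using integrable_abs[OF int_g] by (simp add: abs_mult)
    from integral_abs_bound_integral[OF int_g\<phi> this g\<phi>_le]
    have g_I: "\<bar>LINT x|lebesgue. g x * \<phi> k x\<bar> \<le> I" by (simp add: I_def)
    have int_df\<phi>: "integrable lebesgue (\<lambda>x. frechet_derivative (f j) (at x) b * \<phi> k x)" for j
      using test_function_integrable(2)[OF test_function_mult[OF \<phi>[of k] smooth_partial[OF smf[of j] b]]]
      by (simp add: mult.commute)
    have df\<phi>_le: "\<bar>LINT x|lebesgue. frechet_derivative (f j) (at x) b * \<phi> k x\<bar> \<le> V * L j" for j
    proof -
      have "\<bar>frechet_derivative (f j) (at x) b * \<phi> k x\<bar> \<le> indicator C x * L j" for x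
      proof (cases "x \<in> C")
        case True
        have "\<bar>frechet_derivative (f j) (at x) b * \<phi> k x\<bar> \<le> \<bar>frechet_derivative (f j) (at x) b\<bar>"
          using \<phi>_le[of k x] by (simp add: abs_mult mult_left_le)
        also have "\<dots> \<le> L j" by (rule df_le)
        finally show ?thesis using True by simp
      qed (use test_function_compact_support[OF \<phi>] in auto)
      from integral_abs_bound_integral[OF int_df\<phi> int_C this] show ?thesis
        using C_leb by (simp add: V_def)
    qed
    have "(LINT x|lebesgue. v x * d x) = - (LINT x|lebesgue. (\<Sum>j\<le>k. frechet_derivative (f j) (at x) b * \<phi> k x))"
      using integral_by_parts[OF \<phi>U v b] by (simp add: d_def dv sum_distrib_right)
    also have "\<dots> = - (\<Sum>j\<le>k. LINT x|lebesgue. frechet_derivative (f j) (at x) b * \<phi> k x)"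
      using int_df\<phi> by (subst Bochner_Integration.integral_sum) auto
    also have "\<dots> = - (\<Sum>j<k. LINT x|lebesgue. frechet_derivative (f j) (at x) b * \<phi> k x)
        - (LINT x|lebesgue. frechet_derivative (f k) (at x) b * \<phi> k x)"
      by (simp add: lessThan_Suc_atMost[symmetric])
    \<comment> \<open>The earlier terms cost at most \<open>V\<close> times the sum of their
      gradient bounds, exactly the amount that \<open>low\<close> holds in reserve.\<close>
    also have "\<dots> \<le> V * (\<Sum>j<k. L j) - (real k + V * (\<Sum>j<k. L j) - V)"
    proof -
      have "- (\<Sum>j<k. LINT x|lebesgue. frechet_derivative (f j) (at x) b * \<phi> k x) \<le> V * (\<Sum>j<k. L j)"
        unfolding sum_distrib_left sum_negf[symmetric]
        using df\<phi>_le by (intro sum_mono) (simp add: abs_le_iff)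
      with low[of k] show ?thesis unfolding V_def by linarith
    qed
    finally have vd: "(LINT x|lebesgue. v x * d x) \<le> V - real k" by simp
    have "(LINT x|lebesgue. F x * d x) = - (LINT x|lebesgue. g x * \<phi> k x)"
      using weak \<phi>U unfolding weak_partial_derivative_def F_def d_def by (simp add: lebesgue_on_UNIV_eq)
    moreover have "(LINT x|lebesgue. F x * d x) =
        (LINT x|lebesgue. v x * d x) + (LINT x|lebesgue. F x * d x - v x * d x)"
      using Bochner_Integration.integral_add[OF int_vd int_rest] by simp
    ultimately show ?thesis using vd rest_V g_I by linarith
  qed
  moreover obtain k :: nat where "real k > I + 2 * V" using reals_Archimedean2 by blast
  ultimately show False by (meson not_le)
qed

section \<open>Oscillating building blocks\<close>

lemma frechet_derivative_cutoff_sin: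
  assumes "smooth \<psi>"
  shows "frechet_derivative (\<lambda>x. a * (\<psi> x * sin (\<theta> + x \<bullet> v))) (at x) h =
    a * (frechet_derivative \<psi> (at x) h * sin (\<theta> + x \<bullet> v) + \<psi> x * cos (\<theta> + x \<bullet> v) * (h \<bullet> v))"
proof -
  have "((\<lambda>x. a * (\<psi> x * sin (\<theta> + x \<bullet> v))) has_derivative
    (\<lambda>h. a * (frechet_derivative \<psi> (at x) h * sin (\<theta> + x \<bullet> v) + \<psi> x * cos (\<theta> + x \<bullet> v) * (h \<bullet> v)))) (at x)"
    by (rule derivative_eq_intros smooth_has_derivative[OF assms] refl)+
       (auto simp: algebra_simps fun_eq_iff)
  from frechet_derivative_at[OF this, symmetric] show ?thesis by simp
qed

lemma frechet_derivative_cutoff_cos: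
  assumes "smooth \<psi>"
  shows "frechet_derivative (\<lambda>x. \<psi> x * cos (\<theta> + x \<bullet> v)) (at x) h =
    frechet_derivative \<psi> (at x) h * cos (\<theta> + x \<bullet> v) - \<psi> x * sin (\<theta> + x \<bullet> v) * (h \<bullet> v)"
proof -
  have "((\<lambda>x. \<psi> x * cos (\<theta> + x \<bullet> v)) has_derivative
    (\<lambda>h. frechet_derivative \<psi> (at x) h * cos (\<theta> + x \<bullet> v) - \<psi> x * sin (\<theta> + x \<bullet> v) * (h \<bullet> v))) (at x)"
    by (rule derivative_eq_intros smooth_has_derivative[OF assms] refl)+
       (auto simp: algebra_simps fun_eq_iff)
  from frechet_derivative_at[OF this, symmetric] show ?thesis by simp
qed

section \<open>Neighbourhoods shrinking to \<open>K\<close> and the choice of phase\<close>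

lemma compact_shrinking_neighbourhoods_locally_finite:
  fixes K :: "'a::euclidean_space set"
  assumes "closed K" "K \<noteq> {}" "compact C" "C \<inter> K = {}"
    and U: "\<And>k x. x \<in> U k \<Longrightarrow> infdist x K < 1 / real (Suc k)"
  shows "\<exists>N. \<forall>k\<ge>N. U k \<inter> C = {}"
proof (cases "C = {}")
  case False
  have "continuous_on C (\<lambda>x. infdist x K)" by (intro continuous_intros)
  from continuous_attains_inf[OF assms(3) False this]
  obtain y where y: "y \<in> C" "\<And>x. x \<in> C \<Longrightarrow> infdist y K \<le> infdist x K" by blast
  have "y \<notin> K" using y(1) assms(4) by blast
  \<comment> \<open>The minimal distance from \<open>C\<close> to \<open>K\<close> is positive; once
    1/(k+1) falls below it, \<open>U k\<close> cannot reach \<open>C\<close>.\<close>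
  then have "infdist y K > 0" using assms(1,2) by (rule infdist_pos_not_in_closed[rotated 2])
  then obtain N where N: "1 / real (Suc N) < infdist y K"
    using reals_Archimedean by (auto simp: inverse_eq_divide)
  have "U k \<inter> C = {}" if k: "k \<ge> N" for k
  proof (rule ccontr)
    assume "U k \<inter> C \<noteq> {}"
    then obtain x where x: "x \<in> U k" "x \<in> C" by blast
    have "1 / real (Suc k) \<le> 1 / real (Suc N)" using k by (simp add: frac_le)
    with U[OF x(1)] y(2)[OF x(2)] N show False by linarith
  qed
  then show ?thesis by blast
qed auto

text \<open>Outer regularity makes the excess measure small, and intersecting with a metric
  neighbourhood gives closeness to \<open>K\<close>.\<close>

lemma outer_neighbourhood:
  fixes K :: "'a::euclidean_space set"
  assumes "compact K" "K \<noteq> {}" "\<epsilon> > 0" "\<delta> > 0"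
  obtains U where "open U" "K \<subseteq> U" "\<And>x. x \<in> U \<Longrightarrow> infdist x K < \<epsilon>" "measure lebesgue (U - K) \<le> \<delta>"
proof -
  have K: "K \<in> sets lebesgue" using lmeasurable_compact[OF assms(1)] by auto
  obtain T where T: "open T" "K \<subseteq> T" "T - K \<in> lmeasurable" "emeasure lebesgue (T - K) < ennreal \<delta>"
    using sets_lebesgue_outer_open[OF K assms(4)] by blast
  define U where "U = T \<inter> {x. infdist x K < \<epsilon>}"
  have "open U"
    unfolding U_def using T(1) by (intro open_Int open_Collect_less continuous_intros)
  moreover have "K \<subseteq> U" using T(2) assms(3) by (auto simp: U_def)
  moreover have "measure lebesgue (U - K) \<le> \<delta>"
  proof -
    have "measure lebesgue (U - K) \<le> measure lebesgue (T - K)"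
      using \<open>open U\<close> K T(3) by (intro measure_mono_fmeasurable) (auto simp: U_def[symmetric] borel_open, auto simp: U_def)
    also have "\<dots> \<le> \<delta>"
      using T(4) unfolding emeasure_eq_measure2[OF T(3)]
      by (simp only: ennreal_less_iff[OF measure_nonneg] less_imp_le)
    finally show ?thesis .
  qed
  ultimately show ?thesis using that unfolding U_def by blast
qed

text \<open>The two squares add up to one, so one of the two phases captures half of the measure.\<close>

lemma phase_exists:
  fixes K :: "'a::euclidean_space set"
  assumes K: "K \<in> lmeasurable"
  obtains \<theta> :: real where "measure lebesgue K / 2 \<le> (LINT x|lebesgue. indicator K x * (cos (\<theta> + x \<bullet> v))\<^sup>2)"
proof -
  have int: "integrable lebesgue (\<lambda>x. indicator K x * (cos (\<theta> + x \<bullet> v))\<^sup>2)" for \<theta>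
  proof (rule Bochner_Integration.integrable_bound)
    show K_int: "integrable lebesgue (indicator K :: 'a \<Rightarrow> real)"
      using K by (simp only: lmeasurable_iff_integrable)
    have "(\<lambda>x. (cos (\<theta> + x \<bullet> v))\<^sup>2) \<in> borel_measurable borel"
      by (intro borel_measurable_continuous_onI continuous_intros)
    then have "(\<lambda>x. (cos (\<theta> + x \<bullet> v))\<^sup>2) \<in> borel_measurable lebesgue"
      by (simp add: measurable_completion)
    then show "(\<lambda>x. indicator K x * (cos (\<theta> + x \<bullet> v))\<^sup>2) \<in> borel_measurable lebesgue"
      using borel_measurable_integrable[OF K_int] by (intro borel_measurable_times)
    show "AE x in lebesgue. norm (indicator K x * (cos (\<theta> + x \<bullet> v))\<^sup>2) \<le> norm (indicator K x :: real)"
      by (intro AE_I2) (auto simp: indicator_def abs_square_le_1)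
  qed
  have "(cos (pi/2 + t))\<^sup>2 = (sin t)\<^sup>2" for t by (simp add: cos_add)
  then have "(\<lambda>x. indicator K x * (cos (0 + x \<bullet> v))\<^sup>2 + indicator K x * (cos (pi/2 + x \<bullet> v))\<^sup>2) = (indicator K :: 'a \<Rightarrow> real)"
    by (auto simp: fun_eq_iff indicator_def)
  then have "(LINT x|lebesgue. indicator K x * (cos (0 + x \<bullet> v))\<^sup>2) +
      (LINT x|lebesgue. indicator K x * (cos (pi/2 + x \<bullet> v))\<^sup>2) = measure lebesgue K"
    using Bochner_Integration.integral_add[OF int[of 0] int[of "pi/2"]] K by simp
  then show ?thesis using that[of 0] that[of "pi/2"] by linarith
qed

text \<open>The integrand is a M \<psi>^2 cos^2 plus an error containing the derivative of \<psi>.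
  The first term is nonnegative everywhere and at least a M cos^2 / 4 on \<open>K\<close>. The error
  is at most 1 in size by \<open>d\<close> and lives on \<open>C\<close>, so it costs at most the
  measure of \<open>C\<close>.\<close>

lemma oscillation_lower_bound:
  fixes K :: "'a::euclidean_space set"
  assumes C: "compact C" and K: "K \<in> lmeasurable" and b: "b \<in> Basis"
    and \<psi>: "test_function C \<psi>" "\<And>x. 0 \<le> \<psi> x" "\<And>x. \<psi> x \<le> 1" "\<And>x. x \<in> K \<Longrightarrow> 1/2 \<le> \<psi> x"
    and d: "\<And>x. a * \<bar>frechet_derivative \<psi> (at x) b\<bar> \<le> 1"
    and a: "0 < a" and M: "0 \<le> M"
    and phase: "measure lebesgue K / 2 \<le> (LINT x|lebesgue. indicator K x * (cos (\<theta> + x \<bullet> (M *\<^sub>R b)))\<^sup>2)"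
  shows "a * M * (measure lebesgue K / 8) - measure lebesgue C \<le>
    (LINT x|lebesgue. frechet_derivative (\<lambda>x. a * (\<psi> x * sin (\<theta> + x \<bullet> (M *\<^sub>R b)))) (at x) b *
       (\<psi> x * cos (\<theta> + x \<bullet> (M *\<^sub>R b))))"
proof -
  define s where "s x = sin (\<theta> + x \<bullet> (M *\<^sub>R b))" for x :: 'a
  define c where "c x = cos (\<theta> + x \<bullet> (M *\<^sub>R b))" for x :: 'a
  define d where "d x = frechet_derivative \<psi> (at x) b" for x
  define h where "h x = frechet_derivative (\<lambda>x. a * (\<psi> x * sin (\<theta> + x \<bullet> (M *\<^sub>R b)))) (at x) b * (\<psi> x * c x)" for x
  have sm: "smooth s" "smooth c" "smooth \<psi>"
    using \<psi>(1) unfolding s_def c_def by (intro smooth_sin smooth_cos test_function_smooth)+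
  have h: "h x = a * M * (\<psi> x)\<^sup>2 * (c x)\<^sup>2 + a * d x * s x * \<psi> x * c x" for x
    using b unfolding h_def frechet_derivative_cutoff_sin[OF sm(3)]
    unfolding s_def[symmetric] c_def[symmetric] d_def[symmetric]
    by (simp add: algebra_simps power2_eq_square)
  have int_h: "integrable lebesgue h"
  proof -
    have "test_function C (\<lambda>x. \<psi> x * (c x * frechet_derivative (\<lambda>x. a * (\<psi> x * s x)) (at x) b))"
      using \<psi>(1) b by (intro test_function_mult smooth_mult smooth_partial smooth_const sm)
    from test_function_integrable(2)[OF this] show ?thesis
      by (simp add: h_def[abs_def] s_def mult_ac)
  qed
  have low: "a * M / 4 * (indicator K x * (c x)\<^sup>2) - indicator C x * 1 \<le> h x" for x
  proof (cases "x \<in> C")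
    case True
    have "\<bar>a * d x * s x * \<psi> x * c x\<bar> = (a * \<bar>d x\<bar>) * (\<bar>s x\<bar> * (\<psi> x * \<bar>c x\<bar>))"
      using a \<psi>(2)[of x] by (simp add: abs_mult)
    also have "\<dots> \<le> 1 * (1 * (1 * 1))"
      using assms(8)[of x] \<psi>(2,3)[of x] a unfolding d_def s_def c_def
      by (intro mult_mono) auto
    finally have "- 1 \<le> a * d x * s x * \<psi> x * c x" by linarith
    moreover have "a * M / 4 * (indicator K x * (c x)\<^sup>2) \<le> a * M * (\<psi> x)\<^sup>2 * (c x)\<^sup>2"
    proof (cases "x \<in> K")
      case True
      have "(1/2)\<^sup>2 \<le> (\<psi> x)\<^sup>2" using \<psi>(4)[OF True] by (intro power_mono) auto
      then have "a * M * (1/2)\<^sup>2 * (c x)\<^sup>2 \<le> a * M * (\<psi> x)\<^sup>2 * (c x)\<^sup>2"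
        using a M by (intro mult_right_mono mult_left_mono) auto
      with True show ?thesis by (simp add: power2_eq_square)
    qed (use a M in auto)
    ultimately show ?thesis using True unfolding h by simp
  next
    case False
    then have "\<psi> x = 0" using test_function_compact_support[OF \<psi>(1)] by blast
    moreover from this have "x \<notin> K" using \<psi>(4)[of x] by auto
    ultimately show ?thesis using False by (simp add: h)
  qed
  have int_c: "integrable lebesgue (\<lambda>x. indicator C x * 1 :: real)"
    using lmeasurable_compact[OF C] unfolding lmeasurable_iff_integrable by (intro integrable_mult_left)
  have int_k: "integrable lebesgue (\<lambda>x. indicator K x * (c x)\<^sup>2)"
  proof -
    have "integrable (lebesgue_on C) (\<lambda>x. (c x)\<^sup>2)"
      using C smooth_continuous_on[OF sm(2)]
      by (intro continuous_integrable_lebesgue_on_compact continuous_intros)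
    then have "integrable lebesgue (\<lambda>x. indicator C x *\<^sub>R (c x)\<^sup>2)"
      using lmeasurable_compact[OF C] by (subst (asm) integrable_restrict_space) auto
    from integrable_mult_indicator[OF fmeasurableD[OF K] this]
    have "integrable lebesgue (\<lambda>x. indicator K x *\<^sub>R (indicator C x *\<^sub>R (c x)\<^sup>2))" .
    moreover have "K \<subseteq> C"
      using \<psi>(4) test_function_compact_support[OF \<psi>(1)] by fastforce
    then have "indicator K x *\<^sub>R (indicator C x *\<^sub>R (c x)\<^sup>2) = indicator K x * (c x)\<^sup>2" for x
      by (auto simp: indicator_def)
    ultimately show ?thesis by (simp only:)
  qed
  \<comment> \<open>The 1/8 splits into 1/4 from the square of \<psi> and 1/2 from the
    phase.\<close>
  have "a * M * (measure lebesgue K / 8) = a * M / 4 * (measure lebesgue K / 2)" by simp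
  also have "\<dots> \<le> a * M / 4 * (LINT x|lebesgue. indicator K x * (c x)\<^sup>2)"
    using a M phase unfolding c_def by (intro mult_left_mono) auto
  also have "\<dots> = (LINT x|lebesgue. a * M / 4 * (indicator K x * (c x)\<^sup>2) - indicator C x * 1) + measure lebesgue C"
    using int_k int_c lmeasurable_compact[OF C] by (subst Bochner_Integration.integral_diff) auto
  also have "(LINT x|lebesgue. a * M / 4 * (indicator K x * (c x)\<^sup>2) - indicator C x * 1) \<le> (LINT x|lebesgue. h x)"
    using int_k int_c int_h low
    by (intro Bochner_Integration.integral_mono Bochner_Integration.integrable_diff integrable_mult_right) auto
  finally show ?thesis by (simp add: h_def[abs_def] c_def)
qed

section \<open>The counterexample\<close>

text \<open>The order of choices avoids circularity: the strengths \<open>G\<close> determine the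
  neighbourhoods \<open>U\<close>, these the cutoffs \<psi> with gradient bounds \<open>E\<close>,
  these the amplitudes \<open>a\<close> and frequencies \<open>M\<close>, and the frequencies the
  phases \<theta>.\<close>

lemma sobolev_counterexample:
  fixes K :: "'a::euclidean_space set" and q :: real
  assumes K: "compact K" and pos: "emeasure lebesgue K > 0" and q: "1 \<le> q"
  obtains f :: "'a \<Rightarrow> real" where "continuous_on UNIV f" "f \<in> W1p (ereal q) (- K)"
    "f \<notin> W1p (ereal q) UNIV"
proof -
  obtain b :: 'a where b: "b \<in> Basis" using nonempty_Basis by blast
  have K_lm: "K \<in> lmeasurable" using K by (rule lmeasurable_compact)
  have K_ne: "K \<noteq> {}" using pos by auto
  \<comment> \<open>One compact set containing every \<open>U k\<close>, as their distance bounds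
    1/(k+1) never exceed 1.\<close>
  define D where "D = {x. infdist x K \<le> 1}"
  have D: "compact D" unfolding D_def using K_ne K by (intro compact_infdist_le) auto
  define V where "V = measure lebesgue D"
  define m where "m = measure lebesgue K / 8"
  have m: "0 < m"
    using pos unfolding m_def emeasure_eq_measure2[OF K_lm] by simp

  text \<open>The oscillation strengths \<open>G\<close> are fixed before the neighbourhoods, so that they may
    depend on nothing but their predecessors.\<close>
  define S where "S = rec_nat 0 (\<lambda>k s. s + ((real k + V * s) / m + 1))"
  \<comment> \<open>Chosen so that G k * m = k + V * S k, which is what \<open>low\<close> demands
    of the main term; \<open>m\<close> is the gain per unit of strength in
    \<open>oscillation_lower_bound\<close>.\<close>
  define G where "G k = (real k + V * S k) / m" for k
  \<comment> \<open>The extra 1 pays for the gradient of the cutoff, since \<open>a k * E k\<close>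
    will be at most 1.\<close>
  define L where "L k = G k + 1" for k
  have S_Suc: "S (Suc k) = S k + L k" for k by (simp add: S_def G_def L_def)
  have S_sum: "S k = (\<Sum>j<k. L j)" for k
    by (induction k) (simp_all add: S_Suc, simp add: S_def)
  have V: "0 \<le> V" by (simp add: V_def)
  have "0 \<le> S k" for k
    by (induction k) (use m V in \<open>simp_all add: S_def\<close>)
  then have G: "0 \<le> G k" for k using m V by (simp add: G_def)

  have "\<exists>U. open U \<and> K \<subseteq> U \<and> (\<forall>x\<in>U. infdist x K < 1 / real (Suc k)) \<and>
      S (Suc k) powr q * measure lebesgue (U - K) \<le> (1/2) ^ k" for k
  proof -
    \<comment> \<open>\<open>S (Suc k)\<close> is the sum of \<open>L j\<close> over all j up to and
      including k. The added 1 makes the denominator visibly positive.\<close>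
    define \<delta> where "\<delta> = (1/2) ^ k / (S (Suc k) powr q + 1)"
    have p: "0 < S (Suc k) powr q + 1" by (simp add: add_nonneg_pos)
    then have \<delta>: "0 < \<delta>" by (simp add: \<delta>_def)
    obtain U where U: "open U" "K \<subseteq> U" "\<And>x. x \<in> U \<Longrightarrow> infdist x K < 1 / real (Suc k)"
      "measure lebesgue (U - K) \<le> \<delta>"
      using outer_neighbourhood[OF K K_ne _ \<delta>, of "1 / real (Suc k)"] by auto
    have "S (Suc k) powr q * measure lebesgue (U - K) \<le> (S (Suc k) powr q + 1) * \<delta>"
      using U(4) \<delta> by (intro mult_mono) auto
    also have "\<dots> = (1/2) ^ k" using p by (simp add: \<delta>_def)
    finally show ?thesis using U by blast
  qed
  then obtain U where U: "\<And>k. open (U k)" "\<And>k. K \<subseteq> U k"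
    "\<And>k x. x \<in> U k \<Longrightarrow> infdist x K < 1 / real (Suc k)"
    "\<And>k. S (Suc k) powr q * measure lebesgue (U k - K) \<le> (1/2) ^ k"
    by metis
  have UD: "U k \<subseteq> D" for k
  proof
    fix x assume "x \<in> U k"
    from U(3)[OF this] have "infdist x K < 1 / real (Suc k)" .
    also have "\<dots> \<le> 1" by simp
    finally show "x \<in> D" by (simp add: D_def)
  qed

  have "\<exists>\<psi>. test_function (U k) \<psi> \<and> (\<forall>x. 0 \<le> \<psi> x \<and> \<psi> x \<le> 1) \<and> (\<forall>x\<in>K. 1/2 \<le> \<psi> x)" for k
    using cutoff_exists[OF K U(1) U(2), of k] by metis
  then obtain \<psi> where \<psi>: "\<And>k. test_function (U k) (\<psi> k)"
    "\<And>k x. 0 \<le> \<psi> k x" "\<And>k x. \<psi> k x \<le> 1" "\<And>k x. x \<in> K \<Longrightarrow> 1/2 \<le> \<psi> k x"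
    by metis
  have sm\<psi>: "smooth (\<psi> k)" for k using \<psi>(1) by (rule test_function_smooth)
  have \<psi>D: "test_function D (\<psi> k)" for k using \<psi>(1) UD by (rule test_function_subset)
  have "\<exists>B\<ge>0. \<forall>c\<in>Basis. \<forall>x. \<bar>frechet_derivative (\<psi> k) (at x) c\<bar> \<le> B" for k
  proof -
    have "\<exists>B. \<forall>x. \<bar>frechet_derivative (\<psi> k) (at x) c\<bar> \<le> B" if "c \<in> Basis" for c
      using test_function_bounded[OF test_function_partial[OF \<psi>(1) that], of k] by metis
    then obtain B where B: "\<And>c x. c \<in> Basis \<Longrightarrow> \<bar>frechet_derivative (\<psi> k) (at x) c\<bar> \<le> B c"
      by metis
    then have B0: "0 \<le> B c" if "c \<in> Basis" for c
      using that abs_ge_zero order_trans by blast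
    have "\<bar>frechet_derivative (\<psi> k) (at x) c\<bar> \<le> sum B Basis" if "c \<in> Basis" for c x
      using B[OF that] member_le_sum[OF that, of B] B0 order_trans by fastforce
    with sum_nonneg[of Basis B] B0 show ?thesis by blast
  qed
  then obtain E where E: "\<And>k. 0 \<le> E k"
    "\<And>k c x. c \<in> Basis \<Longrightarrow> \<bar>frechet_derivative (\<psi> k) (at x) c\<bar> \<le> E k"
    by metis

  text \<open>Amplitudes \<open>a\<close> and frequencies \<open>M\<close> with \<open>a k * M k = G k\<close>; here \<open>e k\<close> dominates the
    gradients of all earlier test functions.\<close>
  define e where "e = rec_nat 1 (\<lambda>k e. e + (E k + G k * 2 ^ k * (1 + E k + e)))"
  \<comment> \<open>Each summand of the denominator has its task: 1 gives the bound (1/2)^k on the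
    k-th term, \<open>E k\<close> tames the gradient of its cutoff, and \<open>e k\<close> tames its
    pairing with earlier test functions. \<open>M\<close> is then forced by a k * M k = G k.\<close>
  define a where "a k = (1/2) ^ k / (1 + E k + e k)" for k
  define M where "M k = G k * 2 ^ k * (1 + E k + e k)" for k
  have e_Suc: "e (Suc k) = e k + (E k + M k)" for k by (simp add: e_def M_def)
  have e_ge: "1 \<le> e k" for k
  proof (induction k)
    case (Suc k)
    then have "0 \<le> M k" using G E(1) unfolding M_def by (intro mult_nonneg_nonneg) (auto intro: add_nonneg_nonneg)
    with Suc E(1)[of k] show ?case by (simp add: e_Suc)
  qed (simp add: e_def)
  have den: "0 < 1 + E k + e k" for k using E(1)[of k] e_ge[of k] by linarith
  have M: "0 \<le> M k" for k 
    unfolding M_def using G[of k] den[of k] by (intro mult_nonneg_nonneg) auto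
  have e_mono: "E k + M k \<le> e j" if "k < j" for j k
    using that
  proof (induction j)
    case (Suc j)
    then show ?case
      using e_ge[of j] E(1)[of j] M[of j] by (cases "k = j") (simp_all add: e_Suc)
  qed simp
  have a: "0 < a k" for k using den by (simp add: a_def)
  have aM: "a k * M k = G k" for k
    using den[of k] by (simp add: a_def M_def power_divide)
  have a_le: "a k * t \<le> (1/2) ^ k" if "t \<le> 1 + E k + e k" for k t
  proof -
    have "a k * t \<le> a k * (1 + E k + e k)" using that a by (intro mult_left_mono) (auto simp: less_imp_le)
    also have "\<dots> = (1/2) ^ k" using den[of k] by (simp add: a_def)
    finally show ?thesis .
  qed
  have aE: "a k * E k \<le> 1" for k
    using a_le[of "E k" k] e_ge[of k] power_le_one[of "1/2::real" k] by simp

  have "\<exists>\<theta>. measure lebesgue K / 2 \<le> (LINT x|lebesgue. indicator K x * (cos (\<theta> + x \<bullet> (M k *\<^sub>R b)))\<^sup>2)" for k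
    using phase_exists[OF K_lm] by metis
  then obtain \<theta> where \<theta>: "\<And>k. measure lebesgue K / 2 \<le>
      (LINT x|lebesgue. indicator K x * (cos (\<theta> k + x \<bullet> (M k *\<^sub>R b)))\<^sup>2)"
    by metis
  define s where "s k x = sin (\<theta> k + x \<bullet> (M k *\<^sub>R b))" for k x
  define c where "c k x = cos (\<theta> k + x \<bullet> (M k *\<^sub>R b))" for k x
  define f where "f k x = a k * (\<psi> k x * s k x)" for k x
  define \<phi> where "\<phi> k x = \<psi> k x * c k x" for k x
  have f: "test_function (U k) (f k)" for k
  proof -
    have "test_function (U k) (\<lambda>x. \<psi> k x * s k x * a k)"
      unfolding s_def by (intro test_function_mult \<psi> smooth_sin smooth_const)
    then show ?thesis by (simp add: f_def[abs_def] mult.commute)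
  qed
  have \<phi>: "test_function D (\<phi> k)" for k
    unfolding \<phi>_def c_def by (intro test_function_mult \<psi>D smooth_cos)
  have sc: "\<bar>s k x\<bar> \<le> 1" "\<bar>c k x\<bar> \<le> 1" for k x by (simp_all add: s_def c_def)
  have f_le_a: "\<bar>f k x\<bar> \<le> a k" for k x
  proof -
    have "\<bar>f k x\<bar> = a k * (\<psi> k x * \<bar>s k x\<bar>)"
      using a[of k] \<psi>(2)[of k x] by (simp add: f_def abs_mult)
    also have "\<dots> \<le> a k * (1 * 1)"
      using a[of k] \<psi>(2,3)[of k x] sc(1)[of k x] by (intro mult_left_mono mult_mono) auto
    finally show ?thesis by simp
  qed
  have f_le: "\<bar>f k x\<bar> \<le> (1/2) ^ k" for k x
    using f_le_a[of k x] a_le[of 1 k] E(1)[of k] e_ge[of k] by simp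
  have inner: "\<bar>v \<bullet> (M k *\<^sub>R b)\<bar> \<le> M k" if "v \<in> Basis" for v k
    using that b M[of k] by (auto simp: inner_Basis)
  have df_le: "\<bar>frechet_derivative (f k) (at x) v\<bar> \<le> L k" if v: "v \<in> Basis" for k x v
  proof -
    have "frechet_derivative (f k) (at x) v =
        a k * (frechet_derivative (\<psi> k) (at x) v * s k x + \<psi> k x * c k x * (v \<bullet> (M k *\<^sub>R b)))"
      unfolding f_def[abs_def] s_def c_def by (rule frechet_derivative_cutoff_sin[OF sm\<psi>])
    also have "\<bar>\<dots>\<bar> \<le> a k * (E k * 1 + 1 * 1 * M k)"
      unfolding abs_mult abs_of_pos[OF a]
      using \<psi>(2,3)[of k x] sc[of k x] E(1)[of k] E(2)[OF v, of k x] inner[OF v, of k] a[of k]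
      by (intro mult_left_mono order_trans[OF abs_triangle_ineq] add_mono; simp only: abs_mult)
         (intro mult_mono; auto intro: mult_le_one)+
    \<comment> \<open>The bound is a E + a M, and here a E is at most 1 while a M equals G.\<close>
    also have "\<dots> \<le> L k" using aE[of k] aM[of k] by (simp add: L_def distrib_left)
    finally show ?thesis .
  qed
  have \<phi>_le: "\<bar>\<phi> k x\<bar> \<le> 1" for k x
    unfolding \<phi>_def abs_mult using \<psi>(2,3)[of k x] sc(2)[of k x] by (intro mult_le_one) auto
  have tail: "\<bar>f j x * frechet_derivative (\<phi> k) (at x) b\<bar> \<le> (1/2) ^ j" if kj: "k < j" for j k x
  proof -
    have "frechet_derivative (\<phi> k) (at x) b =
        frechet_derivative (\<psi> k) (at x) b * c k x - \<psi> k x * s k x * (b \<bullet> (M k *\<^sub>R b))"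
      unfolding \<phi>_def[abs_def] s_def c_def by (rule frechet_derivative_cutoff_cos[OF sm\<psi>])
    also have "\<bar>\<dots>\<bar> \<le> E k * 1 + 1 * 1 * M k"
      using \<psi>(2,3)[of k x] sc[of k x] E(1)[of k] E(2)[OF b, of k x] inner[OF b, of k]
      by (intro order_trans[OF abs_triangle_ineq4] add_mono; simp only: abs_mult)
         (intro mult_mono; auto intro: mult_le_one)+
    finally have d: "\<bar>frechet_derivative (\<phi> k) (at x) b\<bar> \<le> E k + M k" by simp
    \<comment> \<open>A later amplitude was chosen after \<open>e j\<close> had absorbed the
      gradient bound E k + M k of the earlier test function.\<close>
    have "\<bar>f j x * frechet_derivative (\<phi> k) (at x) b\<bar> \<le> a j * (E k + M k)"
      unfolding abs_mult using f_le_a d a[of j] by (intro mult_mono) auto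
    also have "\<dots> \<le> (1/2) ^ j"
      using e_mono[OF kj] E(1)[of j] by (intro a_le) simp
    finally show ?thesis .
  qed
  have low: "real k + measure lebesgue D * (\<Sum>j<k. L j) - measure lebesgue D
      \<le> (LINT x|lebesgue. frechet_derivative (f k) (at x) b * \<phi> k x)" for k
  proof -
    have "a k * \<bar>frechet_derivative (\<psi> k) (at x) b\<bar> \<le> 1" for x
      using aE[of k] mult_left_mono[OF E(2)[OF b, of k x] less_imp_le[OF a[of k]]] by linarith
    from oscillation_lower_bound[OF D K_lm b \<psi>D \<psi>(2,3,4) this a M \<theta>, of k]
    have "a k * M k * m - V \<le> (LINT x|lebesgue. frechet_derivative (f k) (at x) b * \<phi> k x)"
      unfolding m_def V_def f_def[abs_def] \<phi>_def s_def c_def by simp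
    \<comment> \<open>Here the choice of \<open>G\<close> pays off: the main term is exactly the
      quantity required by \<open>low\<close>.\<close>
    moreover have "a k * M k * m = real k + V * S k" using m by (simp add: aM G_def)
    ultimately show ?thesis by (simp add: S_sum V_def)
  qed
  define F where "F x = (\<Sum>k. f k x)" for x
  have "continuous_on UNIV F" "F \<in> W1p (ereal q) (- K)"
  proof -
    have locfin: "\<exists>N. \<forall>k\<ge>N. U k \<inter> C = {}" if "compact C" "C \<inter> K = {}" for C
      using compact_shrinking_neighbourhoods_locally_finite[OF compact_imp_closed[OF K] K_ne that U(3)] .
    have "(\<Sum>j\<le>k. L j) powr q * measure lebesgue (U k - K) \<le> (1/2) ^ k" for k
      using U(4)[of k] by (simp add: S_sum lessThan_Suc_atMost)
    from sobolev_series[OF compact_imp_closed[OF K] D UD U(1) locfin f f_le df_le q this]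
    show "continuous_on UNIV F" "F \<in> W1p (ereal q) (- K)"
      unfolding F_def[abs_def] by auto
  qed
  \<comment> \<open>Every weak derivative in direction \<open>b\<close> is excluded, whatever its
    integrability, so the exponent \<open>q\<close> does not enter here.\<close>
  moreover have "F \<notin> W1p (ereal q) UNIV"
    using not_weakly_differentiable_series[OF D b test_function_subset[OF f UD] \<phi> f_le df_le[OF b] \<phi>_le tail low]
      b unfolding W1p_def F_def[abs_def] by blast
  ultimately show ?thesis using that by blast
qed

theorem theorem1p3:
  fixes K :: "(real ^ 'n) set" and p :: ereal
  assumes "compact K"
    and "emeasure lebesgue K > 0"
    and "1 \<le> p" and "p < \<infinity>"
  shows "\<not> W1p_removable p K \<and>
    (\<exists>f :: real ^ 'n \<Rightarrow> real.
       continuous_on UNIV f \<and> f \<in> W1p p (- K) \<and> f \<notin> W1p p UNIV)"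
proof -
  obtain q where q: "p = ereal q" "1 \<le> q" using assms(3,4) by (cases p) (auto simp: one_ereal_def)
  obtain f :: "real ^ 'n \<Rightarrow> real" where "continuous_on UNIV f" "f \<in> W1p p (- K)" "f \<notin> W1p p UNIV"
    using sobolev_counterexample[OF assms(1,2) q(2)] unfolding q(1) .
  then show ?thesis unfolding W1p_removable_def by blast
qed

end
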